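(* Let $\mathcal S$ be a complete structure and let $\Sigma:=\mathsf{h\text{-}encode}(\mathcal S)$, an fd set on attributes $U$. Then $\Sigma$ can be assumed parsimonious with no loss of generality, at the expense of time polynomial in $|\Sigma|\cdot|U|$; that is, from $\Sigma$ one can compute, in time polynomial in $|\Sigma|\cdot|U|$, a parsimonious fd set $\Sigma'$ on $U$ with $(\Sigma')^+=\Sigma^+$.
   Context: **Functional dependencies.** Attributes are symbols; $XY$ denotes $X\cup Y$, and a single attribute is identified with its singleton set. An fd on an attribute set $U$ is a pair $\langle X,Y\rangle$, also written $X\to Y$, with $X,Y\subseteq U$. For an fd set $\Sigma$, $\Sigma^+$ is the set of all fd's derivable from $\Sigma$ by Armstrong's rules: (R0) if $Y\subseteq X$ then $X\to Y$; (R1) if $X\to Y$ then $XZ\to YZ$; (R2) if $X\to Y$ and $Y\to W$ then $X\to W$. An fd set $\Sigma$ is *canonical* if (a) every fd in it has the form $X\to A$ with $|A|=1$; (b) for no $\langle X,A\rangle\in\Sigma$ is $(\Sigma\setminus\{\langle X,A\rangle\})^+=\Sigma^+$; (c) for each $X\to A$ in $\Sigma$ there is no $Y\subsetneq X$ with $(\Sigma\setminus\{X\to A\}\cup\{Y\to A\})^+=\Sigma^+$. It is *parsimonious* if it is canonical and for every $\langle X,A\rangle\in\Sigma$ there is no $Y\subset U$, $Y\ne X$, with $\langle Y,A\rangle\in\Sigma$. **Structures.** A structure is a pair $\mathcal S(\mathcal E,\mathcal V)$, with $\mathcal E$ a finite set of equations over a finite set $\mathcal V$ of variables, $|\mathcal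 E|\le|\mathcal V|$, such that: (a) in any subset of $k$ equations at least $k$ different variables appear; (b) in any subset of $k$ equations in which $r\ge k$ variables appear, if the values of any $r-k$ of these variables are chosen arbitrarily, then the values of the remaining $k$ are determined uniquely. It is *complete* if $|\mathcal E|=|\mathcal V|$. It is *minimal* if it is complete and contains no complete structure $\mathcal S'\subsetneq\mathcal S$ (a substructure being a subset of the equations together with the variables appearing in them). The structure matrix $A_S$ of $\mathcal S$, with equations $f_1,\dots,f_n$ and variables $x_1,\dots,x_m$, has $A_S(i,j)=1$ if $x_j$ appears in $f_i$ and $0$ otherwise. **Procedure $\mathsf{COA}_t(\mathcal S)$** ($\mathcal S$ complete) returns a bijection $\varphi_t:\mathcal E\to\mathcal V$ as follows. For each minimal structure $\mathcal S'\subseteq\mathcal S$, map the equations of $\mathcal S'$ bijectively (arbitrarily) onto the variables of $\mathcal S'$. Then let $\mathcal T$ be obtained from $\mathcal S$ by removing the equations and eliminating the variables of all these minimal structures; if $\mathcal T\neq\varnothing$, recursively add the mapping $\mathsf{COA}_t(\mathcal T)$. **Procedure $\mathsf{h\text{-}encode}(\mathcal S)$** ($\mathcal S$ complete). Variables are identified with attributes, and $\phi,\upsilon$ are two further distinct attribute symbols not among the variables. Start with $\Sigma=\varnothing$ and $\varphi_t=\mathsf{COA}_t(\mathcal S)$. For each $\langle f_k,x_\ell\rangle\in\varphi_t$, let $Z=\{x_j: A_S(k,j)=1\}$; if $|Z|=1$ add the fd $\{\phi\}\to\{x_\ell\}$ to $\Sigma$, otherwise add the fd $(Z\setminus\{x_\ell\})\cup\{\upsilon\}\to\{x_\ell\}$.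 Return $\Sigma$. *)

theory Defs
  imports "HOL-Library.FuncSet" "HOL-Computational_Algebra.Polynomial"
begin

section \<open>Functional dependencies\<close>

type_synonym 'a fd = "'a set \<times> 'a set"

definition fd_set :: "'a set \<Rightarrow> 'a fd set \<Rightarrow> bool" where
  "fd_set U F \<longleftrightarrow> (\<forall>(X, Y) \<in> F. X \<subseteq> U \<and> Y \<subseteq> U)"

inductive_set fd_closure :: "'a set \<Rightarrow> 'a fd set \<Rightarrow> 'a fd set"
  for U :: "'a set" and F :: "'a fd set" where
  base: "(X, Y) \<in> F \<Longrightarrow> (X, Y) \<in> fd_closure U F"
| R0: "Y \<subseteq> X \<Longrightarrow> X \<subseteq> U \<Longrightarrow> (X, Y) \<in> fd_closure U F"
| R1: "(X, Y) \<in> fd_closure U F \<Longrightarrow> Z \<subseteq> U \<Longrightarrow> (X \<union> Z, Y \<union> Z) \<in> fd_closure U F"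
| R2: "(X, Y) \<in> fd_closure U F \<Longrightarrow> (Y, W) \<in> fd_closure U F \<Longrightarrow> (X, W) \<in> fd_closure U F"

definition canonical :: "'a set \<Rightarrow> 'a fd set \<Rightarrow> bool" where
  "canonical U F \<longleftrightarrow>
     (\<forall>(X, A) \<in> F. card A = 1) \<and>
     (\<forall>(X, A) \<in> F. fd_closure U (F - {(X, A)}) \<noteq> fd_closure U F) \<and>
     (\<forall>(X, A) \<in> F. \<not> (\<exists>Y. Y \<subset> X \<and>
        fd_closure U (F - {(X, A)} \<union> {(Y, A)}) = fd_closure U F))"

definition parsimonious :: "'a set \<Rightarrow> 'a fd set \<Rightarrow> bool" where
  "parsimonious U F \<longleftrightarrow> canonical U F \<and>
     (\<forall>(X, A) \<in> F. \<not> (\<exists>Y. Y \<subseteq> U \<and> Y \<noteq> X \<and> (Y, A) \<in> F))"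

section \<open>Structures\<close>

text \<open>Equations are named by elements of type \<open>'e\<close>; the equation named \<open>f\<close> is given by the
  set \<open>appears S f\<close> of its variables and by the predicate \<open>holds S f\<close> telling which
  assignments of values (of type \<open>'d\<close>) satisfy it. Naming equations keeps their identity when
  variables are eliminated from them.\<close>

record ('e, 'v, 'd) eqsys =
  eqs :: "'e set"
  vars :: "'v set"
  appears :: "'e \<Rightarrow> 'v set"
  holds :: "'e \<Rightarrow> ('v \<Rightarrow> 'd) \<Rightarrow> bool"

definition vars_in :: "('e, 'v, 'd) eqsys \<Rightarrow> 'e set \<Rightarrow> 'v set" where
  "vars_in S F = (\<Union>f\<in>F. appears S f)"

definition equation_system :: "('e, 'v, 'd) eqsys \<Rightarrow> bool" where
  "equation_system S \<longleftrightarrow> finite (eqs S) \<and> finite (vars S) \<and>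
     (\<forall>f \<in> eqs S. appears S f \<subseteq> vars S \<and>
        (\<forall>a b. (\<forall>x \<in> appears S f. a x = b x) \<longrightarrow> holds S f a = holds S f b))"

definition is_structure :: "('e, 'v, 'd) eqsys \<Rightarrow> bool" where
  "is_structure S \<longleftrightarrow> equation_system S \<and> card (eqs S) \<le> card (vars S) \<and>
     (\<forall>F \<subseteq> eqs S. card F \<le> card (vars_in S F)) \<and>
     (\<forall>F \<subseteq> eqs S. card F \<le> card (vars_in S F) \<longrightarrow>
        (\<forall>W \<subseteq> vars_in S F. card W = card (vars_in S F) - card F \<longrightarrow>
           (\<forall>a :: 'v \<Rightarrow> 'd. \<exists>!b. b \<in> vars_in S F \<rightarrow>\<^sub>E UNIV \<and>
              (\<forall>x \<in> W. b x = a x) \<and> (\<forall>f \<in> F. holds S f b))))"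

definition complete_structure :: "('e, 'v, 'd) eqsys \<Rightarrow> bool" where
  "complete_structure S \<longleftrightarrow> is_structure S \<and> card (eqs S) = card (vars S)"

definition substructure :: "('e, 'v, 'd) eqsys \<Rightarrow> 'e set \<Rightarrow> ('e, 'v, 'd) eqsys" where
  "substructure S F = S\<lparr>eqs := F, vars := vars_in S F\<rparr>"

text \<open>The structure without equations has to be disregarded here: otherwise it would be a
  proper complete substructure of every other one.\<close>

definition minimal_structure :: "('e, 'v, 'd) eqsys \<Rightarrow> bool" where
  "minimal_structure S \<longleftrightarrow> complete_structure S \<and> eqs S \<noteq> {} \<and>
     \<not> (\<exists>F. F \<noteq> {} \<and> F \<subset> eqs S \<and> complete_structure (substructure S F))"

definition structure_matrix :: "('e, 'v, 'd) eqsys \<Rightarrow> 'e \<Rightarrow> 'v \<Rightarrow> nat" where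
  "structure_matrix S f x = (if x \<in> appears S f then 1 else 0)"

section \<open>Causal ordering\<close>

definition minimal_subs :: "('e, 'v, 'd) eqsys \<Rightarrow> 'e set set" where
  "minimal_subs S = {F. F \<subseteq> eqs S \<and> minimal_structure (substructure S F)}"

text \<open>Remove the equations in \<open>F\<close> and eliminate their variables from the remaining equations.
  The variables are eliminated by projection; whenever the equations in \<open>F\<close> determine
  their variables uniquely, this is the substitution of the determined values.\<close>

definition eliminate :: "('e, 'v, 'd) eqsys \<Rightarrow> 'e set \<Rightarrow> ('e, 'v, 'd) eqsys" where
  "eliminate S F =
     \<lparr>eqs = eqs S - F,
      vars = vars S - vars_in S F,
      appears = (\<lambda>f. appears S f - vars_in S F),
      holds = (\<lambda>f a. \<exists>b. (\<forall>x. x \<notin> vars_in S F \<longrightarrow> b x = a x) \<and>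
                 (\<forall>g \<in> F. holds S g b) \<and> holds S f b)\<rparr>"

text \<open>\<open>coa S \<phi>t\<close>: the mapping \<open>\<phi>t\<close>, as a set of pairs, is a possible result of the causal
  ordering procedure on \<open>S\<close>. The choice of the bijections \<open>g F\<close> makes the procedure
  nondeterministic.\<close>

inductive coa :: "('e, 'v, 'd) eqsys \<Rightarrow> ('e \<times> 'v) set \<Rightarrow> bool" where
  coa_empty: "eqs S = {} \<Longrightarrow> coa S {}"
| coa_step: "eqs S \<noteq> {} \<Longrightarrow>
     \<forall>F \<in> minimal_subs S. bij_betw (g F) F (vars_in S F) \<Longrightarrow>
     coa (eliminate S (\<Union> (minimal_subs S))) \<psi> \<Longrightarrow>
     coa S ((\<Union>F \<in> minimal_subs S. {(f, g F f) |f. f \<in> F}) \<union> \<psi>)"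

definition h_encode :: "'v \<Rightarrow> 'v \<Rightarrow> ('e, 'v, 'd) eqsys \<Rightarrow> 'v fd set \<Rightarrow> bool" where
  "h_encode \<phi> \<upsilon> S F \<longleftrightarrow> (\<exists>\<phi>t. coa S \<phi>t \<and>
     F = {let Z = {y \<in> vars S. structure_matrix S f y = 1}
          in (if card Z = 1 then ({\<phi>}, {x}) else ((Z - {x}) \<union> {\<upsilon>}, {x})) |f x. (f, x) \<in> \<phi>t})"

section \<open>Polynomial-time computation\<close>

text \<open>Random access machines with while-programs. A state consists of finitely many relevant
  registers and an unbounded memory, both holding natural numbers. Every command counts one
  step. The arithmetic operations are restricted to addition and subtraction: with these, uniform
  cost is polynomially related to Turing machine time, whereas it would not be with
  multiplication.\<close>

type_synonym state = "(nat \<Rightarrow> nat) \<times> (nat \<Rightarrow> nat)"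

datatype aexp = Const nat | Reg nat | Mem aexp | Plus aexp aexp | Minus aexp aexp

datatype bexp = Less aexp aexp | Equal aexp aexp | Not bexp | And bexp bexp

datatype com =
  Skip
| Assign nat aexp
| Store aexp aexp
| Seq com com
| If bexp com com
| While bexp com

fun aval :: "aexp \<Rightarrow> state \<Rightarrow> nat" where
  "aval (Const n) s = n"
| "aval (Reg r) s = fst s r"
| "aval (Mem a) s = snd s (aval a s)"
| "aval (Plus a b) s = aval a s + aval b s"
| "aval (Minus a b) s = aval a s - aval b s"

fun bval :: "bexp \<Rightarrow> state \<Rightarrow> bool" where
  "bval (Less a b) s \<longleftrightarrow> aval a s < aval b s"
| "bval (Equal a b) s \<longleftrightarrow> aval a s = aval b s"
| "bval (Not b) s \<longleftrightarrow> \<not> bval b s"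
| "bval (And b c) s \<longleftrightarrow> bval b s \<and> bval c s"

inductive exec :: "com \<Rightarrow> state \<Rightarrow> nat \<Rightarrow> state \<Rightarrow> bool" where
  Skip: "exec Skip s 1 s"
| Assign: "exec (Assign r a) s 1 ((fst s)(r := aval a s), snd s)"
| Store: "exec (Store a b) s 1 (fst s, (snd s)(aval a s := aval b s))"
| Seq: "exec c s t s' \<Longrightarrow> exec d s' t' s'' \<Longrightarrow> exec (Seq c d) s (t + t') s''"
| If_true: "bval b s \<Longrightarrow> exec c s t s' \<Longrightarrow> exec (If b c d) s (1 + t) s'"
| If_false: "\<not> bval b s \<Longrightarrow> exec d s t s' \<Longrightarrow> exec (If b c d) s (1 + t) s'"
| While_true: "bval b s \<Longrightarrow> exec c s t s' \<Longrightarrow> exec (While b c) s' t' s'' \<Longrightarrow>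
     exec (While b c) s (1 + t + t') s''"
| While_false: "\<not> bval b s \<Longrightarrow> exec (While b c) s 1 s"

definition input_state :: "nat list \<Rightarrow> state" where
  "input_state w = ((\<lambda>_. 0), (\<lambda>i. if i < length w then w ! i else 0))"

text \<open>The output is only required to be an initial segment of the memory; the encoding below
  announces its own length.\<close>

definition computes_within :: "com \<Rightarrow> nat list \<Rightarrow> nat \<Rightarrow> nat list \<Rightarrow> bool" where
  "computes_within c w T w' \<longleftrightarrow>
     (\<exists>t s. t \<le> T \<and> exec c (input_state w) t s \<and> (\<forall>i < length w'. snd s i = w' ! i))"

text \<open>A finite fd set on \<open>U\<close> is written as a list of fd's with respect to some numbering of
  the attributes by \<open>0, \<dots>, |U| - 1\<close>. The encoding consists of the number of fd's and the
  number of attributes, followed by the two incidence vectors of each fd.\<close>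

definition bits :: "nat \<Rightarrow> nat set \<Rightarrow> nat list" where
  "bits m N = map (\<lambda>i. if i \<in> N then 1 else 0) [0..<m]"

definition fd_code :: "'a set \<Rightarrow> ('a \<Rightarrow> nat) \<Rightarrow> 'a fd list \<Rightarrow> nat list" where
  "fd_code U num fds = length fds # card U #
     concat (map (\<lambda>(X, Y). bits (card U) (num ` X) @ bits (card U) (num ` Y)) fds)"

end

theory Submission
  imports Defs
begin

text \<open>Hall's condition (a) makes distinct minimal substructures have disjoint variable sets and
  survives the elimination of their union, so every variable is the image of at most one equation
  under the causal ordering. Hence the fd's of the encoding have pairwise distinct right-hand sides
  \<open>{x}\<close> with \<open>x\<close> not on the left, which makes them irredundant and trivially
  satisfies the uniqueness required of parsimonious sets, and both properties are inherited when
  left-hand sides shrink. It remains to reduce the left-hand sides: one pass over all fd's and all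
  attributes, dropping an attribute whenever the attribute closure of the rest still yields the
  right-hand side, suffices because the closure of the fd set never changes.\<close>

section \<open>Right-hand sides of the encoding\<close>

text \<open>\<open>hall_system\<close> isolates the counting part of a structure, because that part
  can be followed through \<open>eliminate\<close> without reasoning about solutions of projected
  equations. One test per pair of fd and attribute is enough although later deletions change the
  set: a verdict speaks about a fixed closure, and a left-hand side that has shrunk since then
  derives no more than before. The program works in place on the encoding. Dropping an attribute
  clears one bit, number and order of the fds stay, and the only additional memory is one bit vector
  behind the input that holds the attribute closure under construction. With n fds and m attributes
  a test runs m rounds over n fds with two scans of m cells each, so the total time is of order
  \<open>n^2 * m^3\<close>. Both sizes are read from the first two memory cells; this is how a
  single program serves all \<open>U\<close>.\<close>

definition hall_system :: "('e, 'v, 'd) eqsys \<Rightarrow> bool" where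
  "hall_system S \<longleftrightarrow> finite (eqs S) \<and> finite (vars S) \<and>
     (\<forall>f \<in> eqs S. appears S f \<subseteq> vars S) \<and> (\<forall>F \<subseteq> eqs S. card F \<le> card (vars_in S F))"

lemma complete_structure_hall: "complete_structure S \<Longrightarrow> hall_system S"
  by (auto simp: complete_structure_def is_structure_def equation_system_def hall_system_def)

lemma vars_in_Un: "vars_in S (F \<union> G) = vars_in S F \<union> vars_in S G"
  by (auto simp: vars_in_def)

lemma vars_in_subset: "hall_system S \<Longrightarrow> F \<subseteq> eqs S \<Longrightarrow> vars_in S F \<subseteq> vars S"
  by (auto simp: vars_in_def hall_system_def)

lemma hall_system_finite:
  "hall_system S \<Longrightarrow> F \<subseteq> eqs S \<Longrightarrow> finite F"
  "hall_system S \<Longrightarrow> F \<subseteq> eqs S \<Longrightarrow> finite (vars_in S F)"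
  using vars_in_subset[of S F] by (auto simp: hall_system_def intro: finite_subset)

lemma hall_systemD: "hall_system S \<Longrightarrow> F \<subseteq> eqs S \<Longrightarrow> card F \<le> card (vars_in S F)"
  by (simp add: hall_system_def)

lemma substructure_simps [simp]:
  "eqs (substructure S F) = F" "vars (substructure S F) = vars_in S F"
  "vars_in (substructure S F) = vars_in S" "appears (substructure S F) = appears S"
  "holds (substructure S F) = holds S" "substructure (substructure S F) G = substructure S G"
  by (auto simp: substructure_def vars_in_def)

text \<open>Conditions (a) and (b) quantify over all sets of equations and see the variables only
  through \<open>vars_in\<close>, so they pass from \<open>F\<close> to \<open>G\<close>. The
  equality of the two counts is all that has to be supplied for \<open>G\<close>.\<close>

lemma complete_substructure:
  assumes "complete_structure (substructure S F)" "G \<subseteq> F" "card G = card (vars_in S G)"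
  shows "complete_structure (substructure S G)"
proof -
  have sub: "vars_in S G \<subseteq> vars_in S F" using assms(2) by (auto simp: vars_in_def)
  have sys: "equation_system (substructure S F)"
    using assms(1) by (simp add: complete_structure_def is_structure_def)
  then have "finite G" "finite (vars_in S G)"
    using sub assms(2) by (auto simp: equation_system_def dest: finite_subset)
  moreover have "\<forall>f\<in>G. appears S f \<subseteq> vars_in S G" by (auto simp: vars_in_def)
  ultimately have sysG: "equation_system (substructure S G)"
    using sys assms(2) unfolding equation_system_def substructure_simps by blast
  have mono: "\<forall>H\<subseteq>F. P H \<Longrightarrow> \<forall>H\<subseteq>G. P H" for P using assms(2) by blast
  have "is_structure (substructure S F)" using assms(1) by (simp add: complete_structure_def)
  note str = this[unfolded is_structure_def substructure_simps]
  have "is_structure (substructure S G)"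
    unfolding is_structure_def substructure_simps
  proof (intro conjI)
    show "card G \<le> card (vars_in S G)" using assms(3) by simp
  qed (fact sysG,
      (rule mono, fact str[THEN conjunct2, THEN conjunct2, THEN conjunct1]),
      (rule mono, fact str[THEN conjunct2, THEN conjunct2, THEN conjunct2]))
  then show ?thesis by (simp add: complete_structure_def assms(3))
qed

text \<open>An uncrossing argument. Hall's condition for \<open>F \<union> G\<close> and
  inclusion-exclusion leave at most \<open>card (F \<inter> G)\<close> common variables, while the
  equations in \<open>F \<inter> G\<close> alone already use that many. So the intersection is
  complete and minimality empties it; the same bound then empties the set of common
  variables.\<close>

lemma minimal_subs_disjoint:
  assumes S: "hall_system S" and F: "F \<in> minimal_subs S" "G \<in> minimal_subs S" "F \<noteq> G"
  shows "F \<inter> G = {} \<and> vars_in S F \<inter> vars_in S G = {}"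
proof -
  let ?V = "vars_in S"
  have sub: "F \<subseteq> eqs S" "G \<subseteq> eqs S" using F by (auto simp: minimal_subs_def)
  have fin: "finite F" "finite G" "finite (?V F)" "finite (?V G)"
    using hall_system_finite[OF S] sub by auto
  have min: "minimal_structure (substructure S F)" "minimal_structure (substructure S G)"
    using F by (auto simp: minimal_subs_def)
  then have compl: "complete_structure (substructure S F)" "complete_structure (substructure S G)"
    by (auto simp: minimal_structure_def)
  then have eq: "card F = card (?V F)" "card G = card (?V G)"
    by (auto simp: complete_structure_def)
  have "card (?V (F \<union> G)) \<ge> card (F \<union> G)" using hall_systemD[OF S] sub by auto
  then have le: "card (?V F \<inter> ?V G) \<le> card (F \<inter> G)"
    using card_Un_Int[of F G] card_Un_Int[of "?V F" "?V G"] fin eq by (simp add: vars_in_Un)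
  have "?V (F \<inter> G) \<subseteq> ?V F \<inter> ?V G" by (auto simp: vars_in_def)
  then have "card (?V (F \<inter> G)) \<le> card (?V F \<inter> ?V G)" using fin by (intro card_mono) auto
  moreover have "card (F \<inter> G) \<le> card (?V (F \<inter> G))"
    using hall_systemD[OF S] sub by (simp add: le_infI1)
  ultimately have "card (F \<inter> G) = card (?V (F \<inter> G))" using le by linarith
  then have int: "complete_structure (substructure S (F \<inter> G))"
    using complete_substructure[OF compl(1)] by blast
  have "H = {} \<or> \<not> H \<subset> K"
    if "minimal_structure (substructure S K)" "complete_structure (substructure S H)" for H K
    using that by (auto simp: minimal_structure_def)
  \<comment> \<open>A nonempty intersection would have to be all of \<open>F\<close> and all of
    \<open>G\<close>, contrary to \<open>F \<noteq> G\<close>.\<close>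
  from this[OF min(1) int] this[OF min(2) int] have "F \<inter> G = {}" using F(3) by blast
  then show ?thesis using le fin by auto
qed

text \<open>Disjointness lets both cardinalities split into sums that agree termwise. Tightness of
  the union is what \<open>hall_eliminate\<close> asks of the eliminated set.\<close>

lemma card_vars_in_minimal_subs:
  assumes S: "hall_system S"
  shows "card (vars_in S (\<Union>(minimal_subs S))) = card (\<Union>(minimal_subs S))"
proof -
  let ?M = "minimal_subs S"
  have sub: "\<And>F. F \<in> ?M \<Longrightarrow> F \<subseteq> eqs S" by (auto simp: minimal_subs_def)
  then have fin: "\<And>F. F \<in> ?M \<Longrightarrow> finite F" "\<And>F. F \<in> ?M \<Longrightarrow> finite (vars_in S F)"
    using hall_system_finite[OF S] by blast+
  have "?M \<subseteq> Pow (eqs S)" using sub by blast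
  then have [simp]: "finite ?M" using S finite_subset by (auto simp: hall_system_def)
  have "vars_in S (\<Union>?M) = (\<Union>F\<in>?M. vars_in S F)" by (auto simp: vars_in_def)
  then have "card (vars_in S (\<Union>?M)) = (\<Sum>F\<in>?M. card (vars_in S F))"
    using fin minimal_subs_disjoint[OF S] by (simp add: card_UN_disjoint)
  also have "\<dots> = (\<Sum>F\<in>?M. card F)"
    by (intro sum.cong)
      (auto simp: minimal_subs_def minimal_structure_def complete_structure_def)
  also have "\<dots> = card (\<Union>F\<in>?M. F)"
    using fin minimal_subs_disjoint[OF S] by (subst card_UN_disjoint) auto
  finally show ?thesis by simp
qed

text \<open>Hall's condition is applied to \<open>F \<union> M\<close>; then \<open>card M\<close>
  cancels, since it counts both the removed equations and the removed variables.\<close>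

lemma hall_eliminate:
  assumes S: "hall_system S" and M: "M \<subseteq> eqs S" "card (vars_in S M) = card M"
  shows "hall_system (eliminate S M)"
proof -
  have "card F \<le> card (vars_in (eliminate S M) F)" if F: "F \<subseteq> eqs S - M" for F
  proof -
    have fin: "finite F" "finite M" "finite (vars_in S F)" "finite (vars_in S M)"
      using hall_system_finite[OF S, of F] hall_system_finite[OF S, of M] F M(1) by auto
    have "card F + card M = card (F \<union> M)"
      using F fin by (subst card_Un_disjoint) auto
    also have "\<dots> \<le> card (vars_in S (F \<union> M))" using F M by (intro hall_systemD[OF S]) auto
    also have "\<dots> = card ((vars_in S F - vars_in S M) \<union> vars_in S M)" by (simp add: vars_in_Un)
    also have "\<dots> = card (vars_in S F - vars_in S M) + card M"
      using fin M by (subst card_Un_disjoint) auto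
    finally have "card F \<le> card (vars_in S F - vars_in S M)" by simp
    moreover have "vars_in (eliminate S M) F = vars_in S F - vars_in S M"
      by (auto simp: vars_in_def eliminate_def)
    ultimately show ?thesis by simp
  qed
  then show ?thesis using S by (auto simp: hall_system_def eliminate_def)
qed

text \<open>Injectivity of \<open>snd\<close> on the pairs says that no variable is assigned twice.
  Within one minimal substructure this is the chosen bijection, between two it is disjointness of
  their variables, and the recursive call only sees variables outside \<open>?W\<close>. The
  inclusion in the product carries this last point through the induction.\<close>

lemma coa_inj:
  assumes "coa S \<psi>" "hall_system S"
  shows "\<psi> \<subseteq> eqs S \<times> vars S \<and> inj_on snd \<psi>"
  using assms
proof (induction rule: coa.induct)
  case (coa_step S g \<psi>)
  let ?M = "minimal_subs S"
  let ?W = "vars_in S (\<Union>?M)"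
  have M: "\<Union>?M \<subseteq> eqs S" by (auto simp: minimal_subs_def)
  then have "hall_system (eliminate S (\<Union>?M))"
    using coa_step.prems card_vars_in_minimal_subs by (intro hall_eliminate) auto
  then have IH: "\<psi> \<subseteq> (eqs S - \<Union>?M) \<times> (vars S - ?W)" "inj_on snd \<psi>"
    using coa_step.IH by (auto simp: eliminate_def)
  define N where "N = (\<Union>F\<in>?M. {(f, g F f) |f. f \<in> F})"
  have g: "g F f \<in> vars_in S F" if "F \<in> ?M" "f \<in> F" for F f
    using coa_step.hyps(2) that by (auto simp: bij_betw_def)
  have N: "N \<subseteq> eqs S \<times> ?W" using M g by (auto simp: N_def vars_in_def)
  have "inj_on snd N"
  proof (rule inj_onI)
    fix u v assume "u \<in> N" "v \<in> N" and eq: "snd u = snd v"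
    then obtain F G f h where u: "F \<in> ?M" "f \<in> F" "u = (f, g F f)"
      and v: "G \<in> ?M" "h \<in> G" "v = (h, g G h)" unfolding N_def by blast
    have "g F f \<in> vars_in S F" "g F f \<in> vars_in S G" using u v eq g[of F f] g[of G h] by auto
    then have "F = G" using minimal_subs_disjoint[OF coa_step.prems u(1) v(1)] by blast
    then show "u = v" using coa_step.hyps(2) u v eq by (auto simp: bij_betw_def dest: inj_onD)
  qed
  moreover have "snd ` N \<inter> snd ` \<psi> = {}" using N IH(1) by fastforce
  then have "snd ` (N - \<psi>) \<inter> snd ` (\<psi> - N) = {}" by blast
  ultimately have "inj_on snd (N \<union> \<psi>)" using IH(2) inj_on_Un by blast
  moreover have "?W \<subseteq> vars S" using vars_in_subset[OF coa_step.prems M] .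
  then have "N \<union> \<psi> \<subseteq> eqs S \<times> vars S" using IH(1) N by (intro Un_least) blast+
  ultimately show ?case unfolding N_def by (rule conjI[rotated])
qed simp

definition separated :: "'a set \<Rightarrow> 'a fd set \<Rightarrow> bool" where
  "separated U F \<longleftrightarrow> inj_on snd F \<and> (\<forall>(X, Y) \<in> F. X \<subseteq> U \<and> (\<exists>x\<in>U. Y = {x} \<and> x \<notin> X))"

text \<open>Neither branch of the encoding puts \<open>x\<close> on the left, since
  \<open>\<phi>\<close> and \<open>\<upsilon>\<close> are not variables; distinct right-hand sides
  come from \<open>coa_inj\<close>.\<close>

lemma h_encode_separated:
  assumes S: "complete_structure S" and new: "\<phi> \<notin> vars S" "\<upsilon> \<notin> vars S" and enc: "h_encode \<phi> \<upsilon> S F"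
  shows "separated (vars S \<union> {\<phi>, \<upsilon>}) F"
proof -
  obtain \<psi> where \<psi>: "coa S \<psi>" and F: "F = {let Z = {y \<in> vars S. structure_matrix S f y = 1}
          in (if card Z = 1 then ({\<phi>}, {x}) else ((Z - {x}) \<union> {\<upsilon>}, {x})) |f x. (f, x) \<in> \<psi>}"
    using enc unfolding h_encode_def by blast
  have inj: "\<psi> \<subseteq> eqs S \<times> vars S" "inj_on snd \<psi>"
    using coa_inj[OF \<psi> complete_structure_hall[OF S]] by auto
  define fd where "fd = (\<lambda>(f, x). let Z = {y \<in> vars S. structure_matrix S f y = 1}
          in (if card Z = 1 then ({\<phi>}, {x}) else ((Z - {x}) \<union> {\<upsilon>}, {x})))"
  have F_eq: "F = fd ` \<psi>" unfolding F fd_def by force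
  have snd_fd: "snd (fd u) = {snd u}" for u by (auto simp: fd_def Let_def split: prod.split)
  have fst_fd: "fst (fd u) \<subseteq> vars S \<union> {\<phi>, \<upsilon>} - {snd u}" if "u \<in> \<psi>" for u
    using that inj(1) new by (auto simp: fd_def Let_def split: prod.splits if_splits)
  have "inj_on snd F"
    using inj(2) by (auto simp: F_eq snd_fd inj_on_def)
  moreover have "snd u \<in> vars S" if "u \<in> \<psi>" for u using inj(1) that by auto
  ultimately show ?thesis unfolding separated_def F_eq
    using fst_fd snd_fd by (fastforce simp: prod_eq_iff)
qed

section \<open>Reducing left-hand sides\<close>

lemma fd_closure_subset:
  assumes "F \<subseteq> fd_closure U G" shows "fd_closure U F \<subseteq> fd_closure U G"
proof -
  have "(X, Y) \<in> fd_closure U G" if "(X, Y) \<in> fd_closure U F" for X Y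
    using that
  proof (induction rule: fd_closure.induct)
    case (base X Y) then show ?case using assms by blast
  next
    case (R2 X Y W) from R2.IH show ?case by (rule fd_closure.R2)
  qed (auto intro: fd_closure.R0 fd_closure.R1)
  then show ?thesis by auto
qed

lemma fd_closure_shrink:
  "(X', Y) \<in> fd_closure U F \<Longrightarrow> X' \<subseteq> X \<Longrightarrow> X \<subseteq> U \<Longrightarrow> (X, Y) \<in> fd_closure U F"
  by (rule fd_closure.R2[OF fd_closure.R0])

lemma fd_closure_extend:
  assumes "(D, C) \<in> fd_closure U F" "(X, Y) \<in> F" "X \<subseteq> C" "C \<subseteq> U"
  shows "(D, C \<union> Y) \<in> fd_closure U F"
proof -
  have "(C, Y) \<in> fd_closure U F" using fd_closure_shrink[OF fd_closure.base] assms(2-4) .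
  from fd_closure.R1[OF this assms(4)] have "(C, C \<union> Y) \<in> fd_closure U F" by (simp add: Un_commute)
  with assms(1) show ?thesis by (rule fd_closure.R2)
qed

definition closed_under :: "'a fd set \<Rightarrow> 'a set \<Rightarrow> bool" where
  "closed_under F C \<longleftrightarrow> (\<forall>(X, Y) \<in> F. X \<subseteq> C \<longrightarrow> Y \<subseteq> C)"

text \<open>A closed set \<open>C\<close> acts as a model of \<open>F\<close>, and every Armstrong
  rule is sound for it. This is the means of refuting derivability.\<close>

lemma closed_under_closure:
  assumes "(X, Y) \<in> fd_closure U F" "closed_under F C" "X \<subseteq> C" shows "Y \<subseteq> C"
  using assms by (induction rule: fd_closure.induct) (auto simp: closed_under_def)

text \<open>The hypotheses make \<open>C\<close> the attribute closure of \<open>X\<close>, which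
  turns derivability into an inclusion that a program can test.\<close>

lemma fd_closure_iff_closed:
  assumes "(X, C) \<in> fd_closure U F" "closed_under F C" "X \<subseteq> C" "C \<subseteq> U"
  shows "(X, Y) \<in> fd_closure U F \<longleftrightarrow> Y \<subseteq> C"
  using assms closed_under_closure fd_closure.R0 fd_closure.R2 by metis

lemma separatedD:
  "separated U F \<Longrightarrow> (X, Y) \<in> F \<Longrightarrow> X \<subseteq> U \<and> (\<exists>x\<in>U. Y = {x} \<and> x \<notin> X)"
  by (auto simp: separated_def)

lemma separated_fd_set: "separated U F \<Longrightarrow> fd_set U F"
  using separatedD[of U F] unfolding fd_set_def by fast

lemma separated_unique: "separated U F \<Longrightarrow> (X, A) \<in> F \<Longrightarrow> (Y, A) \<in> F \<Longrightarrow> X = Y"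
  using inj_onD[of snd F "(X, A)" "(Y, A)"] by (simp add: separated_def)

text \<open>Deleting single attributes covers every proper subset \<open>Y\<close> of
  \<open>X\<close>: some \<open>a\<close> in \<open>X\<close> is missing from \<open>Y\<close>, and
  derivability of \<open>(Y, A)\<close> would yield that of \<open>(X - {a}, A)\<close>.\<close>

lemma separated_parsimonious:
  assumes F: "separated U F"
    and reduced: "\<And>X Y a. (X, Y) \<in> F \<Longrightarrow> a \<in> X \<Longrightarrow> (X - {a}, Y) \<notin> fd_closure U F"
  shows "parsimonious U F"
proof -
  have nonred: "fd_closure U (F - {(X, A)}) \<noteq> fd_closure U F" if XA: "(X, A) \<in> F" for X A
  proof
    assume "fd_closure U (F - {(X, A)}) = fd_closure U F"
    then have der: "(X, A) \<in> fd_closure U (F - {(X, A)})" using XA fd_closure.base by metis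
    obtain x where x: "A = {x}" "x \<notin> X" using F XA by (auto simp: separated_def)
    have "x \<notin> B" if ZB: "(Z, B) \<in> F - {(X, A)}" for Z B
    proof
      assume "x \<in> B"
      then have "B = A" using F ZB x(1) by (auto simp: separated_def)
      then show False using separated_unique[OF F] XA ZB by blast
    qed
    \<comment> \<open>The complement of \<open>{x}\<close> is the refuting model: it contains
      \<open>X\<close> but not \<open>A\<close>.\<close>
    then have "closed_under (F - {(X, A)}) (- {x})" unfolding closed_under_def by blast
    from closed_under_closure[OF der this] show False using x by auto
  qed
  have lreduced: "fd_closure U (F - {(X, A)} \<union> {(Y, A)}) \<noteq> fd_closure U F"
    if XA: "(X, A) \<in> F" and Y: "Y \<subset> X" for X A Y
  proof
    assume "fd_closure U (F - {(X, A)} \<union> {(Y, A)}) = fd_closure U F"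
    then have der: "(Y, A) \<in> fd_closure U F" using fd_closure.base by blast
    obtain a where a: "a \<in> X" "a \<notin> Y" using Y by auto
    have "X \<subseteq> U" using F XA by (auto simp: separated_def)
    then have "(X - {a}, A) \<in> fd_closure U F" using a Y by (intro fd_closure_shrink[OF der]) auto
    with reduced[OF XA a(1)] show False by blast
  qed
  have card1: "card A = 1" if "(X, A) \<in> F" for X A
    using F that by (auto simp: separated_def)
  have uniq: "Y = X" if "(X, A) \<in> F" "(Y, A) \<in> F" for X Y A
    using separated_unique[OF F] that by metis
  show ?thesis unfolding parsimonious_def canonical_def
    by (intro conjI ballI case_prodI2; metis nonred lreduced card1 uniq)
qed

text \<open>Invariant of the double loop at position \<open>(i, b)\<close>, with input
  \<open>fds\<close> and current list \<open>L\<close>: the pairs lexicographically before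
  \<open>(i, b)\<close> are settled. Verdicts refer to the closure of \<open>fds\<close>, so they
  need no revision when \<open>L\<close> changes.\<close>

definition reduction :: "'a set \<Rightarrow> ('a \<Rightarrow> nat) \<Rightarrow> 'a fd list \<Rightarrow> nat \<Rightarrow> nat \<Rightarrow> 'a fd list \<Rightarrow> bool" where
  "reduction U num fds i b L \<longleftrightarrow> map snd L = map snd fds \<and>
     (\<forall>j<length fds. fst (L ! j) \<subseteq> fst (fds ! j)) \<and>
     fd_closure U (set L) = fd_closure U (set fds) \<and>
     (\<forall>j<length fds. \<forall>a\<in>fst (L ! j). j < i \<or> j = i \<and> num a < b \<longrightarrow>
        (fst (L ! j) - {a}, snd (L ! j)) \<notin> fd_closure U (set fds))"

lemma reduction_init: "reduction U num fds 0 0 fds"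
  by (simp add: reduction_def)

lemma reductionD:
  assumes "reduction U num fds i b L"
  shows "map snd L = map snd fds" "fd_closure U (set L) = fd_closure U (set fds)"
    and "length L = length fds"
    and "j < length fds \<Longrightarrow> fst (L ! j) \<subseteq> fst (fds ! j)"
    and "j < length fds \<Longrightarrow> snd (L ! j) = snd (fds ! j)"
    and "\<lbrakk>j < length fds; a \<in> fst (L ! j); j < i \<or> j = i \<and> num a < b\<rbrakk> \<Longrightarrow>
      (fst (L ! j) - {a}, snd (L ! j)) \<notin> fd_closure U (set fds)"
proof -
  show snds: "map snd L = map snd fds" using assms unfolding reduction_def by (elim conjE)
  show "length L = length fds" using snds by (rule map_eq_imp_length_eq)
  then show "j < length fds \<Longrightarrow> snd (L ! j) = snd (fds ! j)"
    using snds nth_map[of j L snd] nth_map[of j fds snd] by simp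
qed (use assms in \<open>unfold reduction_def, blast\<close>)+

lemma reduction_separated:
  assumes "reduction U num fds i b L" "separated U (set fds)" "distinct fds"
  shows "separated U (set L)" "distinct L"
proof -
  have "distinct (map snd L)"
    using assms(2,3) by (simp add: reductionD(1)[OF assms(1)] distinct_map separated_def)
  moreover have "X \<subseteq> U \<and> (\<exists>x\<in>U. Y = {x} \<and> x \<notin> X)" if XY: "(X, Y) \<in> set L" for X Y
  proof -
    obtain j where j: "j < length fds" "L ! j = (X, Y)"
      using XY unfolding in_set_conv_nth reductionD(3)[OF assms(1)] by blast
    obtain X' where X': "fds ! j = (X', Y)" using reductionD(5)[OF assms(1) j(1)] j(2)
      by (cases "fds ! j") simp
    then have "X \<subseteq> X'" using reductionD(4)[OF assms(1) j(1)] j(2) by simp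
    moreover have "(X', Y) \<in> set fds" using X' j(1) by (metis nth_mem)
    then have "X' \<subseteq> U \<and> (\<exists>x\<in>U. Y = {x} \<and> x \<notin> X')"
      using separatedD[OF assms(2)] by blast
    ultimately show ?thesis by blast
  qed
  ultimately show "separated U (set L)" "distinct L"
    by (auto simp: separated_def distinct_map)
qed

text \<open>As \<open>m\<close> exceeds every attribute number, the positions \<open>(i, m)\<close>
  and \<open>(Suc i, 0)\<close> settle the same pairs.\<close>

lemma reduction_next:
  assumes "reduction U num fds i m L" "separated U (set fds)" "distinct fds" "\<And>a. a \<in> U \<Longrightarrow> num a < m"
  shows "reduction U num fds (Suc i) 0 L"
proof -
  have "a \<in> U" if "j < length fds" "a \<in> fst (L ! j)" for j a
  proof -
    have "L ! j \<in> set L" using that reductionD(3)[OF assms(1)] by simp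
    then show ?thesis
      using separatedD[OF reduction_separated(1)[OF assms(1-3)], of "fst (L ! j)" "snd (L ! j)"] that(2)
      by auto
  qed
  then show ?thesis using assms(4) reductionD[OF assms(1)] unfolding reduction_def
    by (intro conjI allI ballI impI) (auto simp: less_Suc_eq)
qed

lemma reduction_step:
  assumes red: "reduction U num fds i b L" and sep: "separated U (set fds)" "distinct fds"
    and i: "i < length fds" and a: "a \<in> U" "num a = b" "inj_on num U" and Li: "L ! i = (X, Y)"
    and X': "X' = (if (X - {a}, Y) \<in> fd_closure U (set L) then X - {a} else X)"
  shows "reduction U num fds i (Suc b) (L[i := (X', Y)])"
proof -
  let ?L = "L[i := (X', Y)]" and ?cl = "fd_closure U (set fds)"
  have len: "length L = length fds" using red by (rule reductionD)
  have cl: "fd_closure U (set L) = ?cl" using red by (rule reductionD)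
  have "(X, Y) \<in> set L" using i len Li by (metis nth_mem)
  then have XU: "X \<subseteq> U" and XY: "(X, Y) \<in> ?cl"
    using separatedD[OF reduction_separated(1)[OF red sep]] cl fd_closure.base[of X Y "set L" U]
    by auto
  have X'_sub: "X' \<subseteq> X" by (auto simp: X')
  have X'Y: "(X', Y) \<in> ?cl" using XY by (auto simp: X' cl)
  have sub: "set ?L \<subseteq> insert (X', Y) (set L)" by (rule set_update_subset_insert)
  have "set ?L \<subseteq> ?cl"
    using sub X'Y cl fd_closure.base[of _ _ "set L" U] by auto
  moreover have "set L \<subseteq> fd_closure U (set ?L)"
  proof -
    have "(X', Y) \<in> fd_closure U (set ?L)"
      using i len by (intro fd_closure.base set_update_memI) simp
    then have "(X, Y) \<in> fd_closure U (set ?L)" using X'_sub XU by (rule fd_closure_shrink)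
    \<comment> \<open>Writing \<open>(X, Y)\<close> back at position \<open>i\<close> of
      \<open>?L\<close> restores \<open>L\<close>.\<close>
    moreover have "set L \<subseteq> insert (X, Y) (set ?L)"
      using set_update_subset_insert[of ?L i "(X, Y)"] Li by (metis list_update_id list_update_overwrite)
    ultimately show ?thesis using fd_closure.base[of _ _ "set ?L" U] by auto
  qed
  ultimately have cl': "fd_closure U (set ?L) = ?cl"
    using fd_closure_subset[of "set ?L" U "set fds"] fd_closure_subset[of "set L" U "set ?L"] cl
    by auto
  have snds: "map snd ?L = map snd fds"
    using reductionD(1)[OF red] Li i len
    by (simp add: map_update list_update_same_conv reductionD(5)[OF red] flip: reductionD(5)[OF red i])
  have fsts: "\<forall>j<length fds. fst (?L ! j) \<subseteq> fst (fds ! j)"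
  proof (intro allI impI)
    fix j assume "j < length fds"
    then show "fst (?L ! j) \<subseteq> fst (fds ! j)"
      using reductionD(4)[OF red, of j] Li X'_sub len by (cases "j = i") auto
  qed
  \<comment> \<open>If \<open>c = a\<close>, presence of \<open>a\<close> in \<open>X'\<close> means
    that the test failed. For any other \<open>c\<close> the earlier verdict on \<open>X\<close>
    carries over to the smaller \<open>X'\<close>.\<close>
  have done_i: "(X' - {c}, Y) \<notin> ?cl" if c: "c \<in> X'" "num c < Suc b" for c
  proof (cases "c = a")
    case True
    then show ?thesis using c by (auto simp: X' cl split: if_splits)
  next
    case False
    have "c \<in> U" using c X'_sub XU by auto
    then have "num c < b" using False c(2) a by (auto simp: less_Suc_eq dest: inj_onD)
    then have "(X - {c}, Y) \<notin> ?cl" using reductionD(6)[OF red i, of c] Li c X'_sub by auto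
    moreover have "(X - {c}, Y) \<in> ?cl" if "(X' - {c}, Y) \<in> ?cl"
      by (rule fd_closure_shrink[OF that]) (use X'_sub XU in auto)
    ultimately show ?thesis by blast
  qed
  have "(fst (?L ! j) - {c}, snd (?L ! j)) \<notin> ?cl"
    if "j < length fds" "c \<in> fst (?L ! j)" "j < i \<or> j = i \<and> num c < Suc b" for j c
  proof (cases "j = i")
    case True
    then show ?thesis using that done_i i len by auto
  next
    case False
    then show ?thesis using that reductionD(6)[OF red] by auto
  qed
  then show ?thesis using cl' snds fsts unfolding reduction_def
    by (intro conjI allI ballI impI) blast+
qed

lemma reduction_final:
  assumes "reduction U num fds (length fds) 0 L" "separated U (set fds)" "distinct fds"
  shows "parsimonious U (set L)"
proof (rule separated_parsimonious[OF reduction_separated(1)[OF assms]])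
  fix X Y a assume XY: "(X, Y) \<in> set L" "a \<in> X"
  then obtain j where "j < length fds" "L ! j = (X, Y)"
    unfolding in_set_conv_nth reductionD(3)[OF assms(1)] by blast
  then have "(X - {a}, Y) \<notin> fd_closure U (set fds)"
    using reductionD(6)[OF assms(1), of j a] XY(2) by auto
  then show "(X - {a}, Y) \<notin> fd_closure U (set L)" by (simp add: reductionD(2)[OF assms(1)])
qed

section \<open>A program logic with time bounds\<close>

definition reaches :: "com \<Rightarrow> state \<Rightarrow> nat \<Rightarrow> (state \<Rightarrow> bool) \<Rightarrow> bool" where
  "reaches c s T Q \<longleftrightarrow> (\<exists>t s'. t \<le> T \<and> exec c s t s' \<and> Q s')"

lemma reaches_mono:
  "reaches c s T P \<Longrightarrow> T \<le> T' \<Longrightarrow> (\<And>s'. P s' \<Longrightarrow> Q s') \<Longrightarrow> reaches c s T' Q"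
  unfolding reaches_def by (meson order_trans)

lemma reaches_Assign: "Q ((fst s)(r := aval a s), snd s) \<Longrightarrow> reaches (Assign r a) s 1 Q"
  unfolding reaches_def using exec.Assign by blast

lemma reaches_Store: "Q (fst s, (snd s)(aval a s := aval b s)) \<Longrightarrow> reaches (Store a b) s 1 Q"
  unfolding reaches_def using exec.Store by blast

lemma reaches_Seq:
  "reaches c s T (\<lambda>s'. reaches d s' T' Q) \<Longrightarrow> reaches (Seq c d) s (T + T') Q"
  unfolding reaches_def by (meson add_mono exec.Seq)

definition for_loop :: "nat \<Rightarrow> aexp \<Rightarrow> com \<Rightarrow> com" where
  "for_loop r e c = Seq (Assign r (Const 0))
     (While (Less (Reg r) e) (Seq c (Assign r (Plus (Reg r) (Const 1)))))"

text \<open>The 2 pays for the initial assignment and the final failing guard; each round adds a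
  guard and an increment to \<open>T\<close>. The guard evaluates \<open>e\<close> anew every time,
  so \<open>bound\<close> ties its value to the invariant.\<close>

lemma reaches_for:
  assumes init: "I 0 ((fst s)(r := 0), snd s)"
    and step: "\<And>k s. k < N \<Longrightarrow> fst s r = k \<Longrightarrow> I k s \<Longrightarrow>
      reaches c s T (\<lambda>s'. fst s' r = k \<and> I (Suc k) ((fst s')(r := Suc k), snd s'))"
    and bound: "\<And>k s. I k s \<Longrightarrow> aval e s = N"
    and final: "\<And>s. I N s \<Longrightarrow> Q s"
  shows "reaches (for_loop r e c) s (2 + N * (T + 2)) Q"
proof -
  let ?b = "Seq c (Assign r (Plus (Reg r) (Const 1)))"
  have loop: "reaches (While (Less (Reg r) e) ?b) s (1 + d * (T + 2)) Q"
    if "I k s" "fst s r = k" "k + d = N" for k d s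
    using that
  proof (induction d arbitrary: k s)
    case 0
    then have "\<not> bval (Less (Reg r) e) s" using bound by simp
    then have "exec (While (Less (Reg r) e) ?b) s 1 s" by (rule exec.While_false)
    moreover have "Q s" using 0 final by simp
    ultimately show ?case unfolding reaches_def by (intro exI[of _ 1] exI[of _ s]) simp
  next
    case (Suc d)
    then have b: "bval (Less (Reg r) e) s" using bound by fastforce
    obtain t s' where t: "t \<le> T" "exec c s t s'" "fst s' r = k"
      "I (Suc k) ((fst s')(r := Suc k), snd s')"
      using step[of k s] Suc.prems unfolding reaches_def by auto
    let ?s = "((fst s')(r := Suc k), snd s')"
    have body: "exec ?b s (t + 1) ?s"
      using exec.Seq[OF t(2) exec.Assign[of r "Plus (Reg r) (Const 1)"]] t(3) by simp
    obtain t' s'' where t': "t' \<le> 1 + d * (T + 2)" "exec (While (Less (Reg r) e) ?b) ?s t' s''" "Q s''"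
      using Suc.IH[of "Suc k" ?s] t(4) Suc.prems unfolding reaches_def by auto
    have "exec (While (Less (Reg r) e) ?b) s (1 + (t + 1) + t') s''"
      using b body t'(2) by (rule exec.While_true)
    moreover have "1 + (t + 1) + t' \<le> 1 + Suc d * (T + 2)" using t(1) t'(1) by simp
    ultimately show ?case using t'(3) unfolding reaches_def by blast
  qed
  have "reaches (for_loop r e c) s (1 + (1 + N * (T + 2))) Q"
    unfolding for_loop_def using init by (intro reaches_Seq reaches_Assign loop[of 0]) auto
  then show ?thesis by simp
qed


section \<open>The reduction program\<close>

definition bits_at :: "(nat \<Rightarrow> nat) \<Rightarrow> nat \<Rightarrow> nat \<Rightarrow> nat set \<Rightarrow> bool" where
  "bits_at M a m N \<longleftrightarrow> (\<forall>k<m. M (a + k) = of_bool (k \<in> N))"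

text \<open>Register conventions: 0, 2, 3, 5, 6 are loop counters (0 and 6 over fd's, 2 and 3 over
  attributes, 5 over rounds), 1 points to the fd being reduced, 4 to the scratch vector behind the
  input, 7 to the vector under inspection, and 8 holds the outcome of the inclusion test. Truncated subtraction
  on \<open>{0, 1}\<close> replaces conditionals.\<close>

definition test_com :: com where
  "test_com = Seq (Assign 8 (Const 1)) (for_loop 3 (Mem (Const 1))
     (Assign 8 (Minus (Reg 8)
        (Minus (Mem (Plus (Reg 7) (Reg 3))) (Mem (Plus (Reg 4) (Reg 3)))))))"

text \<open>The inner difference is 1 exactly at an attribute of \<open>X\<close> missing from
  \<open>C\<close>, and under truncated subtraction a flag that has become 0 stays 0.\<close>

lemma test_com:
  assumes "snd s 1 = m" "bits_at (snd s) (fst s 7) m X" "bits_at (snd s) (fst s 4) m C" "X \<subseteq> {..<m}"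
    and Q: "\<And>s'. snd s' = snd s \<Longrightarrow> fst s' 8 = of_bool (X \<subseteq> C) \<Longrightarrow>
      (\<And>r. r \<notin> {3, 8} \<Longrightarrow> fst s' r = fst s r) \<Longrightarrow> Q s'"
  shows "reaches test_com s (3 + 3 * m) Q"
proof -
  define I where "I k s' \<longleftrightarrow> snd s' = snd s \<and> fst s' 8 = of_bool (\<forall>l<k. l \<in> X \<longrightarrow> l \<in> C) \<and>
    (\<forall>r. r \<notin> {3, 8} \<longrightarrow> fst s' r = fst s r)" for k s'
  have "reaches test_com s (1 + (2 + m * (1 + 2))) Q"
    unfolding test_com_def
  proof (rule reaches_Seq, rule reaches_Assign, rule reaches_for[where I = I])
    fix k s' assume k: "k < m" "fst s' 3 = k" "I k s'"
    then show "reaches (Assign 8 (Minus (Reg 8)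
        (Minus (Mem (Plus (Reg 7) (Reg 3))) (Mem (Plus (Reg 4) (Reg 3)))))) s' 1
      (\<lambda>s''. fst s'' 3 = k \<and> I (Suc k) ((fst s'')(3 := Suc k), snd s''))"
      using assms(2,3) by (intro reaches_Assign) (auto simp: I_def bits_at_def less_Suc_eq)
  next
    fix s' assume "I m s'"
    moreover have "(\<forall>l<m. l \<in> X \<longrightarrow> l \<in> C) \<longleftrightarrow> X \<subseteq> C" using assms(4) by auto
    ultimately show "Q s'" by (intro Q) (auto simp: I_def)
  qed (use assms(1) in \<open>auto simp: I_def\<close>)
  then show ?thesis by (rule reaches_mono) auto
qed

text \<open>On bits, \<open>(x + y) - 1\<close> is conjunction and \<open>1 - ((1 - x) - y)\<close>
  is disjunction. The stored value is thus: old bit, or (flag and bit of the right-hand side), the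
  latter vector lying \<open>m\<close> cells behind the left one.\<close>

definition fire_com :: com where
  "fire_com = Seq test_com (for_loop 3 (Mem (Const 1))
     (Store (Plus (Reg 4) (Reg 3)) (Minus (Const 1)
        (Minus (Minus (Const 1) (Mem (Plus (Reg 4) (Reg 3))))
           (Minus (Plus (Reg 8) (Mem (Plus (Plus (Reg 7) (Mem (Const 1))) (Reg 3)))) (Const 1))))))"

text \<open>The address conditions keep the attribute count in cell 1 and the vectors of the fd
  clear of the scratch vector being written.\<close>

lemma fire_com:
  assumes m: "snd s 1 = m" and XY: "bits_at (snd s) (fst s 7) m X" "bits_at (snd s) (fst s 7 + m) m Y"
    and C: "bits_at (snd s) (fst s 4) m C" and X: "X \<subseteq> {..<m}"
    and addr: "1 < fst s 4" "fst s 7 + 2 * m \<le> fst s 4"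
    and Q: "\<And>s'. bits_at (snd s') (fst s 4) m (if X \<subseteq> C then C \<union> Y else C) \<Longrightarrow>
      (\<And>a. a < fst s 4 \<Longrightarrow> snd s' a = snd s a) \<Longrightarrow>
      (\<And>r. r \<notin> {3, 8} \<Longrightarrow> fst s' r = fst s r) \<Longrightarrow> Q s'"
  shows "reaches fire_com s (5 + 6 * m) Q"
proof -
  let ?C = "if X \<subseteq> C then C \<union> Y else C"
  define I where "I k s' \<longleftrightarrow> (\<forall>a<fst s 4. snd s' a = snd s a) \<and>
    (\<forall>l<m. snd s' (fst s 4 + l) = of_bool (l \<in> (if l < k then ?C else C))) \<and>
    fst s' 8 = of_bool (X \<subseteq> C) \<and> (\<forall>r. r \<notin> {3, 8} \<longrightarrow> fst s' r = fst s r)" for k s'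
  have "reaches fire_com s ((3 + 3 * m) + (2 + m * (1 + 2))) Q"
    unfolding fire_com_def
  proof (rule reaches_Seq, rule test_com[OF m XY(1) C X], rule reaches_for[where I = I])
    fix s' assume s': "snd s' = snd s" "fst s' 8 = of_bool (X \<subseteq> C)"
      "\<And>r. r \<notin> {3, 8} \<Longrightarrow> fst s' r = fst s r"
    show "I 0 ((fst s')(3 := 0), snd s')" using s' C by (auto simp: I_def bits_at_def)
  next
    fix k s' assume k: "k < m" "fst s' 3 = k" "I k s'"
    have "snd s' (fst s 7 + m + k) = of_bool (k \<in> Y)" "snd s' 1 = m"
      using k addr XY(2) m by (auto simp: I_def bits_at_def)
    then show "reaches (Store (Plus (Reg 4) (Reg 3)) (Minus (Const 1)
        (Minus (Minus (Const 1) (Mem (Plus (Reg 4) (Reg 3))))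
           (Minus (Plus (Reg 8) (Mem (Plus (Plus (Reg 7) (Mem (Const 1))) (Reg 3)))) (Const 1))))) s' 1
      (\<lambda>s''. fst s'' 3 = k \<and> I (Suc k) ((fst s'')(3 := Suc k), snd s''))"
      using k by (intro reaches_Store) (auto simp: I_def less_Suc_eq)
  next
    fix s' assume "I m s'"
    then show "Q s'" by (intro Q) (auto simp: I_def bits_at_def)
  qed (use addr m in \<open>auto simp: I_def\<close>)
  then show ?thesis by (rule reaches_mono) auto
qed


definition skip_fd :: "nat \<Rightarrow> com" where
  "skip_fd r = Assign r (Plus (Reg r) (Plus (Mem (Const 1)) (Mem (Const 1))))"

definition pass_com :: com where
  "pass_com = Seq (Assign 7 (Const 2)) (for_loop 6 (Mem (Const 0)) (Seq fire_com (skip_fd 7)))"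

definition closure_com :: com where
  "closure_com = for_loop 5 (Mem (Const 1)) pass_com"

text \<open>Presence of the attribute is not tested first. If its bit is 0, the reduced fd is the fd
  itself, so the inclusion test succeeds and the truncated \<open>0 - 1\<close> leaves the bit
  0.\<close>

definition reduce_com :: com where
  "reduce_com =
     Seq (for_loop 3 (Mem (Const 1)) (Store (Plus (Reg 4) (Reg 3)) (Mem (Plus (Reg 1) (Reg 3)))))
    (Seq (Store (Plus (Reg 4) (Reg 2)) (Const 0))
    (Seq closure_com
    (Seq (Assign 7 (Plus (Reg 1) (Mem (Const 1))))
    (Seq test_com
    (Store (Plus (Reg 1) (Reg 2)) (Minus (Mem (Plus (Reg 1) (Reg 2))) (Reg 8)))))))"

text \<open>The first loop computes the scratch address \<open>2 + 2 * m * n\<close> for n fds by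
  repeated addition, the machine having no multiplication.\<close>

definition main_com :: com where
  "main_com =
     Seq (Assign 4 (Const 2))
    (Seq (for_loop 0 (Mem (Const 0)) (skip_fd 4))
    (Seq (Assign 1 (Const 2))
    (for_loop 0 (Mem (Const 0)) (Seq (for_loop 2 (Mem (Const 1)) reduce_com) (skip_fd 1)))))"

lemma block_address_inj:
  fixes q :: nat
  assumes "q * i + k = q * j + l" "k < q" "l < q"
  shows "i = j \<and> k = l"
proof -
  have "(q * i + k) div q = (q * j + l) div q" "(q * i + k) mod q = (q * j + l) mod q"
    using assms(1) by simp_all
  then show ?thesis using assms(2,3) by simp
qed

lemma block_address_le: "i < n \<Longrightarrow> q * i + q \<le> q * (n :: nat)"
  using mult_le_mono2[of "Suc i" n q] by simp

section \<open>Memory layout of fd lists and correctness of the program\<close>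

locale attribute_numbering =
  fixes U :: "'a set" and num :: "'a \<Rightarrow> nat" and m :: nat
  assumes num: "bij_betw num U {0..<m}"
begin

lemma inj_num: "inj_on num U" and num_less: "a \<in> U \<Longrightarrow> num a < m"
  and finite_U: "finite U" and card_U: "card U = m"
  using num bij_betw_finite[OF num] bij_betw_same_card[OF num] by (auto simp: bij_betw_def)

lemma num_image: "X \<subseteq> U \<Longrightarrow> num ` X \<subseteq> {..<m}"
  using num_less by auto

lemma num_image_subset_iff: "X \<subseteq> U \<Longrightarrow> Y \<subseteq> U \<Longrightarrow> num ` X \<subseteq> num ` Y \<longleftrightarrow> X \<subseteq> Y"
  by (auto simp: subset_iff image_iff dest: inj_onD[OF inj_num]) (metis inj_onD[OF inj_num])

text \<open>The address form of \<open>fd_code\<close>: the record of fd \<open>i\<close> starts at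
  \<open>2 + 2 * m * i\<close>. Cells behind the last record are unconstrained, which leaves room
  for the scratch vector.\<close>

definition fds_at :: "(nat \<Rightarrow> nat) \<Rightarrow> 'a fd list \<Rightarrow> bool" where
  "fds_at M L \<longleftrightarrow> M 0 = length L \<and> M 1 = m \<and> (\<forall>i<length L.
     bits_at M (2 + 2 * m * i) m (num ` fst (L ! i)) \<and>
     bits_at M (2 + 2 * m * i + m) m (num ` snd (L ! i)))"

lemma fds_at_cong:
  assumes "fds_at M L" "\<And>a. a < 2 + 2 * m * length L \<Longrightarrow> M' a = M a"
  shows "fds_at M' L"
proof -
  have "2 + 2 * m * i + m + k < 2 + 2 * m * length L" if "i < length L" "k < m" for i k
    using block_address_le[OF that(1), of "2 * m"] that(2) by linarith
  moreover have "2 + 2 * m * i + k < 2 + 2 * m * length L" if "i < length L" "k < m" for i k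
    using block_address_le[OF that(1), of "2 * m"] that(2) by linarith
  ultimately show ?thesis using assms unfolding fds_at_def bits_at_def by auto
qed

lemma fds_at_update:
  assumes M: "fds_at M L" and i: "i < length L" "b < m" and v: "v = of_bool (b \<in> num ` X)"
    and same: "\<And>k. k < m \<Longrightarrow> k \<noteq> b \<Longrightarrow> k \<in> num ` X \<longleftrightarrow> k \<in> num ` fst (L ! i)"
  shows "fds_at (M(2 + 2 * m * i + b := v)) (L[i := (X, snd (L ! i))])"
proof -
  let ?M = "M(2 + 2 * m * i + b := v)" and ?L = "L[i := (X, snd (L ! i))]"
  have "?M (2 + 2 * m * j + k) = of_bool (k \<in> num ` fst (?L ! j)) \<and>
      ?M (2 + 2 * m * j + m + k) = of_bool (k \<in> num ` snd (?L ! j))"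
    if j: "j < length L" "k < m" for j k
  proof
    \<comment> \<open>Uniqueness of quotient and remainder modulo \<open>2 * m\<close> separates the
      cells.\<close>
    have eq: "2 + 2 * m * j + k = 2 + 2 * m * i + b \<longleftrightarrow> j = i \<and> k = b"
      using block_address_inj[of "2 * m" j k i b] j i by auto
    show "?M (2 + 2 * m * j + k) = of_bool (k \<in> num ` fst (?L ! j))"
      unfolding fun_upd_apply eq
      using M j i same v by (cases "j = i") (auto simp: fds_at_def bits_at_def)
    have "2 + 2 * m * j + m + k \<noteq> 2 + 2 * m * i + b"
      using block_address_inj[of "2 * m" j "m + k" i b] j i by auto
    then show "?M (2 + 2 * m * j + m + k) = of_bool (k \<in> num ` snd (?L ! j))"
      unfolding fun_upd_apply
      using M j i by (cases "j = i") (auto simp: fds_at_def bits_at_def)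
  qed
  then show ?thesis using M by (auto simp: fds_at_def bits_at_def)
qed

text \<open>\<open>C0\<close> is the set at the start of the pass, \<open>C\<close> the set after
  \<open>j\<close> fds. The clause on closed \<open>C0\<close> makes a fixpoint stable; the last
  clause shows that a full pass without change has found one. Firing tests the current
  \<open>C\<close>, which contains \<open>C0\<close>, so gains within a pass do no harm.\<close>

definition partial_pass :: "'a fd list \<Rightarrow> 'a set \<Rightarrow> 'a set \<Rightarrow> nat \<Rightarrow> 'a set \<Rightarrow> bool" where
  "partial_pass L D C0 j C \<longleftrightarrow> C0 \<subseteq> C \<and> C \<subseteq> U \<and> (D, C) \<in> fd_closure U (set L) \<and>
     (closed_under (set L) C0 \<longrightarrow> C = C0) \<and> (\<forall>l<j. fst (L ! l) \<subseteq> C0 \<longrightarrow> snd (L ! l) \<subseteq> C)"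

lemma partial_pass_step:
  assumes pass: "partial_pass L D C0 j C" and j: "j < length L" and L: "fd_set U (set L)"
  shows "partial_pass L D C0 (Suc j) (if fst (L ! j) \<subseteq> C then C \<union> snd (L ! j) else C)"
proof -
  have mem: "(fst (L ! j), snd (L ! j)) \<in> set L" using j by simp
  then have "snd (L ! j) \<subseteq> U" using L unfolding fd_set_def by blast
  moreover have "(D, C \<union> snd (L ! j)) \<in> fd_closure U (set L)" if "fst (L ! j) \<subseteq> C"
    using pass fd_closure_extend[OF _ mem that] by (simp add: partial_pass_def)
  moreover have "snd (L ! j) \<subseteq> C0" if "closed_under (set L) C0" "fst (L ! j) \<subseteq> C0"
    using that mem unfolding closed_under_def by blast
  ultimately show ?thesis using pass unfolding partial_pass_def less_Suc_eq by auto
qed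

lemma pass_com:
  assumes M: "fds_at (snd s) L" and base: "fst s 4 = 2 + 2 * m * length L"
    and L: "fd_set U (set L)" and C0: "bits_at (snd s) (fst s 4) m (num ` C0)" "C0 \<subseteq> U"
    and D: "(D, C0) \<in> fd_closure U (set L)"
    and Q: "\<And>s' C. bits_at (snd s') (fst s 4) m (num ` C) \<Longrightarrow> partial_pass L D C0 (length L) C \<Longrightarrow>
      (\<And>a. a < fst s 4 \<Longrightarrow> snd s' a = snd s a) \<Longrightarrow>
      (\<And>r. r \<notin> {3, 6, 7, 8} \<Longrightarrow> fst s' r = fst s r) \<Longrightarrow> Q s'"
  shows "reaches pass_com s (3 + length L * (8 + 6 * m)) Q"
proof -
  define I where "I j s' \<longleftrightarrow> (\<exists>C. bits_at (snd s') (fst s 4) m (num ` C) \<and> partial_pass L D C0 j C) \<and>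
    fst s' 7 = 2 + 2 * m * j \<and> (\<forall>a<fst s 4. snd s' a = snd s a) \<and>
    (\<forall>r. r \<notin> {3, 6, 7, 8} \<longrightarrow> fst s' r = fst s r)" for j s'
  have I_mem: "fds_at (snd s') L" if "I j s'" for j s'
    using M by (rule fds_at_cong) (use that base in \<open>auto simp: I_def\<close>)
  have "reaches pass_com s (1 + (2 + length L * ((5 + 6 * m) + 1 + 2))) Q"
    unfolding pass_com_def
  proof (rule reaches_Seq, rule reaches_Assign, rule reaches_for[where I = I])
    have "partial_pass L D C0 0 C0" using C0 D by (simp add: partial_pass_def)
    then show "I 0 ((fst (((fst s)(7 := aval (Const 2) s), snd s)))(6 := 0),
        snd ((fst s)(7 := aval (Const 2) s), snd s))"
      using C0 by (auto simp: I_def)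
  next
    fix j s' assume j: "j < length L" "fst s' 6 = j" "I j s'"
    obtain C where C: "bits_at (snd s') (fst s 4) m (num ` C)" "partial_pass L D C0 j C"
      using j(3) by (auto simp: I_def)
    have s': "fst s' 7 = 2 + 2 * m * j" "fst s' 4 = fst s 4" using j(3) by (auto simp: I_def)
    have M': "fds_at (snd s') L" using j(3) by (rule I_mem)
    have "(fst (L ! j), snd (L ! j)) \<in> set L" using j(1) by simp
    then have X: "fst (L ! j) \<subseteq> U" using L unfolding fd_set_def by blast
    show "reaches (Seq fire_com (skip_fd 7)) s' ((5 + 6 * m) + 1)
      (\<lambda>s''. fst s'' 6 = j \<and> I (Suc j) ((fst s'')(6 := Suc j), snd s''))"
    proof (rule reaches_Seq, rule fire_com)
      show "snd s' 1 = m" "bits_at (snd s') (fst s' 7) m (num ` fst (L ! j))"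
        "bits_at (snd s') (fst s' 7 + m) m (num ` snd (L ! j))"
        using M' j(1) s' by (auto simp: fds_at_def)
      show "bits_at (snd s') (fst s' 4) m (num ` C)" using C s' by simp
      show "num ` fst (L ! j) \<subseteq> {..<m}" using X by (rule num_image)
      show "1 < fst s' 4" "fst s' 7 + 2 * m \<le> fst s' 4"
        using base s' block_address_le[OF j(1), of "2 * m"] by auto
    next
      fix s'' assume bits: "bits_at (snd s'') (fst s' 4) m
          (if num ` fst (L ! j) \<subseteq> num ` C then num ` C \<union> num ` snd (L ! j) else num ` C)"
        and frame: "\<And>a. a < fst s' 4 \<Longrightarrow> snd s'' a = snd s' a" "\<And>r. r \<notin> {3, 8} \<Longrightarrow> fst s'' r = fst s' r"
      have CU: "C \<subseteq> U" using C(2) by (simp add: partial_pass_def)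
      let ?C = "if fst (L ! j) \<subseteq> C then C \<union> snd (L ! j) else C"
      have "bits_at (snd s'') (fst s 4) m (num ` ?C)"
        using bits s' by (simp add: num_image_subset_iff[OF X CU] image_Un split: if_splits)
      then have "\<exists>C. bits_at (snd s'') (fst s 4) m (num ` C) \<and> partial_pass L D C0 (Suc j) C"
        using partial_pass_step[OF C(2) j(1) L] by blast
      moreover have "snd s'' 1 = m" using frame(1)[of 1] s' base M' by (simp add: fds_at_def)
      ultimately show "reaches (skip_fd 7) s'' 1
          (\<lambda>s''. fst s'' 6 = j \<and> I (Suc j) ((fst s'')(6 := Suc j), snd s''))"
        unfolding skip_fd_def using j frame s'
        by (intro reaches_Assign) (auto simp: I_def)
    qed
  next
    fix s' assume "I (length L) s'"
    then show "Q s'" using Q unfolding I_def by blast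
  qed (use I_mem in \<open>auto simp: fds_at_def\<close>)
  then show ?thesis by (rule reaches_mono) (auto simp: algebra_simps)
qed

text \<open>A round that does not reach a closed set adds an attribute, so \<open>m\<close> rounds suffice.\<close>

lemma closure_com:
  assumes M: "fds_at (snd s) L" and base: "fst s 4 = 2 + 2 * m * length L"
    and L: "fd_set U (set L)" and D: "bits_at (snd s) (fst s 4) m (num ` D)" "D \<subseteq> U"
    and Q: "\<And>s' C. bits_at (snd s') (fst s 4) m (num ` C) \<Longrightarrow>
      (D, C) \<in> fd_closure U (set L) \<Longrightarrow> closed_under (set L) C \<Longrightarrow> D \<subseteq> C \<Longrightarrow> C \<subseteq> U \<Longrightarrow>
      (\<And>a. a < fst s 4 \<Longrightarrow> snd s' a = snd s a) \<Longrightarrow>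
      (\<And>r. r \<notin> {3, 5, 6, 7, 8} \<Longrightarrow> fst s' r = fst s r) \<Longrightarrow> Q s'"
  shows "reaches closure_com s (2 + m * (5 + length L * (8 + 6 * m))) Q"
proof -
  define I where "I r s' \<longleftrightarrow> (\<exists>C. bits_at (snd s') (fst s 4) m (num ` C) \<and> D \<subseteq> C \<and> C \<subseteq> U \<and>
      (D, C) \<in> fd_closure U (set L) \<and> (closed_under (set L) C \<or> r \<le> card C)) \<and>
    (\<forall>a<fst s 4. snd s' a = snd s a) \<and>
    (\<forall>r. r \<notin> {3, 5, 6, 7, 8} \<longrightarrow> fst s' r = fst s r)" for r s'
  have I_mem: "fds_at (snd s') L" if "I r s'" for r s'
    using M by (rule fds_at_cong) (use that base in \<open>auto simp: I_def\<close>)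
  have "reaches closure_com s (2 + m * ((3 + length L * (8 + 6 * m)) + 2)) Q"
    unfolding closure_com_def
  proof (rule reaches_for[where I = I])
    have "(D, D) \<in> fd_closure U (set L)" using D(2) by (intro fd_closure.R0) auto
    then show "I 0 ((fst s)(5 := 0), snd s)" using D by (auto simp: I_def)
  next
    fix r s' assume r: "r < m" "fst s' 5 = r" "I r s'"
    obtain C where C: "bits_at (snd s') (fst s 4) m (num ` C)" "D \<subseteq> C" "C \<subseteq> U"
      "(D, C) \<in> fd_closure U (set L)" "closed_under (set L) C \<or> r \<le> card C"
      using r(3) by (auto simp: I_def)
    have s': "fst s' 4 = fst s 4" using r(3) by (auto simp: I_def)
    show "reaches pass_com s' (3 + length L * (8 + 6 * m))
      (\<lambda>s''. fst s'' 5 = r \<and> I (Suc r) ((fst s'')(5 := Suc r), snd s''))"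
    proof (rule pass_com[OF I_mem[OF r(3)] _ L])
      show "bits_at (snd s') (fst s' 4) m (num ` C)" "fst s' 4 = 2 + 2 * m * length L"
        using C s' base by auto
    next
      fix s'' C' assume bits: "bits_at (snd s'') (fst s' 4) m (num ` C')"
        and pass: "partial_pass L D C (length L) C'"
        and frame: "\<And>a. a < fst s' 4 \<Longrightarrow> snd s'' a = snd s' a"
          "\<And>r. r \<notin> {3, 6, 7, 8} \<Longrightarrow> fst s'' r = fst s' r"
      have C': "C \<subseteq> C'" "C' \<subseteq> U" "(D, C') \<in> fd_closure U (set L)" using pass
        by (auto simp: partial_pass_def)
      have "closed_under (set L) C' \<or> Suc r \<le> card C'"
      proof (cases "C' = C")
        case True
        then have "closed_under (set L) C'"
          using pass by (fastforce simp: closed_under_def partial_pass_def in_set_conv_nth)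
        then show ?thesis ..
      next
        case False
        \<comment> \<open>A change rules out that \<open>C\<close> was closed, which leaves the
          cardinality alternative of the invariant.\<close>
        then have "r \<le> card C" using C(5) pass by (auto simp: partial_pass_def)
        moreover have "card C < card C'"
          using False C' finite_subset[OF C'(2) finite_U] by (intro psubset_card_mono) auto
        ultimately show ?thesis by simp
      qed
      then show "fst s'' 5 = r \<and> I (Suc r) ((fst s'')(5 := Suc r), snd s'')"
        using bits C' C(2) frame s' r by (auto simp: I_def)
    qed (use C in auto)
  next
    fix s' assume "I m s'"
    then obtain C where C: "bits_at (snd s') (fst s 4) m (num ` C)" "D \<subseteq> C" "C \<subseteq> U"
      "(D, C) \<in> fd_closure U (set L)" "closed_under (set L) C \<or> m \<le> card C"
      and frame: "\<And>a. a < fst s 4 \<Longrightarrow> snd s' a = snd s a"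
        "\<And>r. r \<notin> {3, 5, 6, 7, 8} \<Longrightarrow> fst s' r = fst s r"
      unfolding I_def by blast
    have "closed_under (set L) C"
    proof (cases "m \<le> card C")
      case True
      \<comment> \<open>Having \<open>m\<close> attributes forces \<open>C = U\<close>, and
        \<open>U\<close> is closed because all fds live on it.\<close>
      then have "C = U" using card_seteq[OF finite_U C(3)] card_U by simp
      then show ?thesis using L by (auto simp: closed_under_def fd_set_def)
    qed (use C(5) in blast)
    then show "Q s'" using Q C frame by blast
  qed (use I_mem in \<open>auto simp: fds_at_def\<close>)
  then show ?thesis by (rule reaches_mono) (auto simp: algebra_simps)
qed

lemma reduce_com:
  assumes M: "fds_at (snd s) L" and base: "fst s 4 = 2 + 2 * m * length L"
    and L: "fd_set U (set L)" and i: "i < length L" "L ! i = (X, Y)" "fst s 1 = 2 + 2 * m * i"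
    and b: "a \<in> U" "num a = b" "fst s 2 = b"
    and Q: "\<And>s'. fds_at (snd s')
        (L[i := (if (X - {a}, Y) \<in> fd_closure U (set L) then X - {a} else X, Y)]) \<Longrightarrow>
      (\<And>r. r \<notin> {3, 5, 6, 7, 8} \<Longrightarrow> fst s' r = fst s r) \<Longrightarrow> Q s'"
  shows "reaches reduce_com s (10 + 6 * m + m * (5 + length L * (8 + 6 * m))) Q"
proof -
  have bm: "b < m" using b num_less by auto
  have "(X, Y) \<in> set L" using i by (metis nth_mem)
  then have XY: "X \<subseteq> U" "Y \<subseteq> U" using L by (auto simp: fd_set_def)
  have below: "fst s 1 + m + k < fst s 4" "fst s 1 + k < fst s 4" if "k < m" for k
    using block_address_le[OF i(1), of "2 * m"] that base i(3) by auto
  have Xbits: "bits_at (snd s) (fst s 1) m (num ` X)"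
    and Ybits: "bits_at (snd s) (fst s 1 + m) m (num ` Y)" using M i by (auto simp: fds_at_def)
  have diff: "num ` (X - {a}) = num ` X - {b}"
    using XY(1) b inj_onD[OF inj_num] by blast
  define I where "I k s' \<longleftrightarrow> (\<forall>l<k. snd s' (fst s 4 + l) = of_bool (l \<in> num ` X)) \<and>
    (\<forall>a<fst s 4. snd s' a = snd s a) \<and> (\<forall>r. r \<noteq> 3 \<longrightarrow> fst s' r = fst s r)" for k s'
  have I_mem: "fds_at (snd s') L" if "I r s'" for r s'
    using M by (rule fds_at_cong) (use that base in \<open>auto simp: I_def\<close>)
  have "reaches reduce_com s ((2 + m * (1 + 2)) + (1 + ((2 + m * (5 + length L * (8 + 6 * m))) +
      (1 + ((3 + 3 * m) + 1))))) Q"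
    unfolding reduce_com_def
  proof (rule reaches_Seq, rule reaches_for[where I = I])
    fix k s' assume k: "k < m" "fst s' 3 = k" "I k s'"
    have "snd s' (fst s 1 + k) = of_bool (k \<in> num ` X)"
      using Xbits below(2)[OF k(1)] k by (auto simp: I_def bits_at_def)
    then show "reaches (Store (Plus (Reg 4) (Reg 3)) (Mem (Plus (Reg 1) (Reg 3)))) s' 1
      (\<lambda>s''. fst s'' 3 = k \<and> I (Suc k) ((fst s'')(3 := Suc k), snd s''))"
      using k by (intro reaches_Store) (auto simp: I_def less_Suc_eq)
  next
    fix s1 assume s1: "I m s1"
    let ?s2 = "(fst s1, (snd s1)(fst s 4 + b := 0))"
    have M2: "fds_at (snd ?s2) L"
      using I_mem[OF s1] by (rule fds_at_cong) (use base in auto)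
    have bits2: "bits_at (snd ?s2) (fst ?s2 4) m (num ` (X - {a}))"
      using s1 by (auto simp: diff I_def bits_at_def)
    have frame2: "fst ?s2 r = fst s r" if "r \<noteq> 3" for r using that s1 by (auto simp: I_def)
    have "reaches (Seq closure_com (Seq (Assign 7 (Plus (Reg 1) (Mem (Const 1)))) (Seq test_com
        (Store (Plus (Reg 1) (Reg 2)) (Minus (Mem (Plus (Reg 1) (Reg 2))) (Reg 8)))))) ?s2
      ((2 + m * (5 + length L * (8 + 6 * m))) + (1 + ((3 + 3 * m) + 1))) Q"
    proof (rule reaches_Seq, rule closure_com[OF M2 _ L bits2])
      show "X - {a} \<subseteq> U" "fst ?s2 4 = 2 + 2 * m * length L" using XY base frame2[of 4] by auto
    next
      fix s3 C assume C: "bits_at (snd s3) (fst ?s2 4) m (num ` C)" "(X - {a}, C) \<in> fd_closure U (set L)"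
          "closed_under (set L) C" "X - {a} \<subseteq> C" "C \<subseteq> U"
        and frame: "\<And>a. a < fst ?s2 4 \<Longrightarrow> snd s3 a = snd ?s2 a"
          "\<And>r. r \<notin> {3, 5, 6, 7, 8} \<Longrightarrow> fst s3 r = fst ?s2 r"
      have low: "snd s3 c = snd s c" if "c < fst s 4" for c
        using that frame(1)[of c] frame2[of 4] s1 by (auto simp: I_def)
      have M3: "fds_at (snd s3) L" using M by (rule fds_at_cong) (use low base in auto)
      have regs: "fst s3 r = fst s r" if "r \<notin> {3, 5, 6, 7, 8}" for r
        using that frame(2) frame2 by auto
      show "reaches (Seq (Assign 7 (Plus (Reg 1) (Mem (Const 1)))) (Seq test_com
          (Store (Plus (Reg 1) (Reg 2)) (Minus (Mem (Plus (Reg 1) (Reg 2))) (Reg 8))))) s3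
        (1 + ((3 + 3 * m) + 1)) Q"
      proof (rule reaches_Seq, rule reaches_Assign, rule reaches_Seq, rule test_com)
        show "num ` Y \<subseteq> {..<m}" using XY(2) by (rule num_image)
      next
        fix s4
        let ?r = "(fst s3)(7 := aval (Plus (Reg 1) (Mem (Const 1))) s3)"
        assume s4: "snd s4 = snd (?r, snd s3)" "fst s4 8 = of_bool (num ` Y \<subseteq> num ` C)"
          "\<And>r. r \<notin> {3, 8} \<Longrightarrow> fst s4 r = fst (?r, snd s3) r"
        \<comment> \<open>The scratch vector now holds the attribute closure of
          \<open>X - {a}\<close>, and injectivity of \<open>num\<close> makes inclusion of the bit
          vectors faithful.\<close>
        have test: "fst s4 8 = of_bool ((X - {a}, Y) \<in> fd_closure U (set L))"
          using s4(2) fd_closure_iff_closed[OF C(2-5)] num_image_subset_iff[OF XY(2) C(5)] by simp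
        let ?X = "if (X - {a}, Y) \<in> fd_closure U (set L) then X - {a} else X"
        have "snd s4 (2 + 2 * m * i + b) = of_bool (b \<in> num ` X)"
          using M3 s4(1) i bm by (auto simp: fds_at_def bits_at_def)
        then have "snd s4 (2 + 2 * m * i + b) - fst s4 8 = of_bool (b \<in> num ` ?X)"
          by (simp add: test diff)
        moreover have "k \<in> num ` ?X \<longleftrightarrow> k \<in> num ` fst (L ! i)" if "k \<noteq> b" for k
          using that i(2) diff by auto
        moreover have "fds_at (snd s4) L" using M3 s4(1) by simp
        ultimately have "fds_at ((snd s4)(2 + 2 * m * i + b := snd s4 (2 + 2 * m * i + b) - fst s4 8))
            (L[i := (?X, snd (L ! i))])"
          using i(1) bm by (intro fds_at_update) auto
        moreover have regs4: "fst s4 r = fst s r" if "r \<notin> {3, 5, 6, 7, 8}" for r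
          using that s4(3)[of r] regs[of r] by simp
        moreover have "fst s4 1 = 2 + 2 * m * i" "fst s4 2 = b"
          using regs4[of 1] regs4[of 2] i(3) b(3) by auto
        ultimately show "reaches (Store (Plus (Reg 1) (Reg 2))
            (Minus (Mem (Plus (Reg 1) (Reg 2))) (Reg 8))) s4 1 Q"
          using i(2) by (intro reaches_Store Q) auto
      qed (use M3 C(1) regs Ybits low below frame2 in \<open>auto simp: fds_at_def bits_at_def\<close>)
    qed
    then show "reaches (Seq (Store (Plus (Reg 4) (Reg 2)) (Const 0)) (Seq closure_com
        (Seq (Assign 7 (Plus (Reg 1) (Mem (Const 1)))) (Seq test_com
        (Store (Plus (Reg 1) (Reg 2)) (Minus (Mem (Plus (Reg 1) (Reg 2))) (Reg 8))))))) s1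
      (1 + ((2 + m * (5 + length L * (8 + 6 * m))) + (1 + ((3 + 3 * m) + 1)))) Q"
      using frame2[of 4] frame2[of 2] b(3) by (intro reaches_Seq[of _ _ 1] reaches_Store) simp
  qed (use I_mem in \<open>auto simp: I_def fds_at_def\<close>)
  then show ?thesis by (rule reaches_mono) (auto simp: algebra_simps)
qed

lemma main_com:
  assumes M: "fds_at (snd s) fds" and sep: "separated U (set fds)" "distinct fds"
    and Q: "\<And>s' L. fds_at (snd s') L \<Longrightarrow> reduction U num fds (length fds) 0 L \<Longrightarrow> Q s'"
  shows "reaches main_com s (6 + length fds * (8 + m * (12 + 6 * m + m * (5 + length fds * (8 + 6 * m))))) Q"
proof -
  let ?n = "length fds"
  let ?T = "10 + 6 * m + m * (5 + ?n * (8 + 6 * m))"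
  define S where "S k s' \<longleftrightarrow> snd s' = snd s \<and> fst s' 4 = 2 + 2 * m * k" for k and s' :: state
  define R where "R i b s' \<longleftrightarrow> (\<exists>L. reduction U num fds i b L \<and> fds_at (snd s') L) \<and>
    fst s' 4 = 2 + 2 * m * ?n \<and> fst s' 1 = 2 + 2 * m * i" for i b and s' :: state
  have R_len: "snd s' 0 = ?n" "snd s' 1 = m" if "R i b s'" for i b s'
    using that reductionD(3) by (fastforce simp: R_def fds_at_def)+
  have body: "reaches (for_loop 2 (Mem (Const 1)) reduce_com) s1 (2 + m * (?T + 2))
      (\<lambda>s2. fst s2 0 = i \<and> R i m s2)" if i: "i < ?n" and s1: "fst s1 0 = i" "R i 0 s1" for i s1
  proof (rule reaches_for[where I = "\<lambda>b s'. fst s' 0 = i \<and> R i b s'"])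
    fix b s' assume b: "b < m" "fst s' 2 = b" and s': "fst s' 0 = i \<and> R i b s'"
    then obtain L where L: "reduction U num fds i b L" "fds_at (snd s') L" by (auto simp: R_def)
    have len: "length L = ?n" using L(1) by (rule reductionD)
    \<comment> \<open>The loop counts numbers; surjectivity of \<open>num\<close> supplies the
      attribute that stands behind \<open>b\<close>.\<close>
    obtain a where a: "a \<in> U" "num a = b" using num b(1) unfolding bij_betw_def
      by (metis atLeastLessThan_iff imageE le0)
    obtain X Y where XY: "L ! i = (X, Y)" by (cases "L ! i")
    have fd: "fd_set U (set L)"
      using reduction_separated(1)[OF L(1) sep] by (rule separated_fd_set)
    show "reaches reduce_com s' ?T (\<lambda>s''. fst s'' 2 = b \<and>
        (fst ((fst s'')(2 := Suc b), snd s'') 0 = i \<and> R i (Suc b) ((fst s'')(2 := Suc b), snd s'')))"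
      unfolding len[symmetric]
    proof (rule reduce_com[OF L(2) _ fd _ XY _ a b(2)])
      fix s'' assume s'': "fds_at (snd s'')
          (L[i := (if (X - {a}, Y) \<in> fd_closure U (set L) then X - {a} else X, Y)])"
        "\<And>r. r \<notin> {3, 5, 6, 7, 8} \<Longrightarrow> fst s'' r = fst s' r"
      show "fst s'' 2 = b \<and> (fst ((fst s'')(2 := Suc b), snd s'') 0 = i \<and>
          R i (Suc b) ((fst s'')(2 := Suc b), snd s''))"
        using reduction_step[OF L(1) sep i a inj_num XY refl] s' s'' b(2) unfolding R_def by auto
    qed (use s' i in \<open>auto simp: R_def len\<close>)
  next
    show "fst ((fst s1)(2 := 0), snd s1) 0 = i \<and> R i 0 ((fst s1)(2 := 0), snd s1)"
      using s1 by (simp add: R_def)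
  next
    fix b s' assume "fst s' 0 = i \<and> R i b s'"
    then show "aval (Mem (Const 1)) s' = m" using R_len(2)[of i b s'] by simp
  qed simp
  have "reaches main_com s (1 + ((2 + ?n * (1 + 2)) + (1 + (2 + ?n * (((2 + m * (?T + 2)) + 1) + 2))))) Q"
    unfolding main_com_def
  proof (rule reaches_Seq, rule reaches_Assign, rule reaches_Seq, rule reaches_for[where I = S])
    fix k s' assume "k < ?n" "fst s' 0 = k" "S k s'"
    then show "reaches (skip_fd 4) s' 1
        (\<lambda>s''. fst s'' 0 = k \<and> S (Suc k) ((fst s'')(0 := Suc k), snd s''))"
      unfolding skip_fd_def using M by (intro reaches_Assign) (auto simp: S_def fds_at_def)
  next
    fix s1 assume s1: "S ?n s1"
    show "reaches (Seq (Assign 1 (Const 2)) (for_loop 0 (Mem (Const 0))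
        (Seq (for_loop 2 (Mem (Const 1)) reduce_com) (skip_fd 1)))) s1
      (1 + (2 + ?n * (((2 + m * (?T + 2)) + 1) + 2))) Q"
    proof (rule reaches_Seq, rule reaches_Assign, rule reaches_for[where I = "\<lambda>i. R i 0"])
      show "R 0 0 ((fst ((fst s1)(1 := aval (Const 2) s1), snd s1))(0 := 0),
          snd ((fst s1)(1 := aval (Const 2) s1), snd s1))"
        using s1 M reduction_init by (auto simp: R_def S_def)
    next
      fix i s2 assume i: "i < ?n" "fst s2 0 = i" "R i 0 s2"
      show "reaches (Seq (for_loop 2 (Mem (Const 1)) reduce_com) (skip_fd 1)) s2
          ((2 + m * (?T + 2)) + 1)
          (\<lambda>s3. fst s3 0 = i \<and> R (Suc i) 0 ((fst s3)(0 := Suc i), snd s3))"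
      proof (rule reaches_Seq, rule reaches_mono[OF body[OF i] order_refl])
        fix s3 assume s3: "fst s3 0 = i \<and> R i m s3"
        then obtain L where L: "reduction U num fds i m L" "fds_at (snd s3) L" by (auto simp: R_def)
        have "reduction U num fds (Suc i) 0 L" using L(1) sep num_less by (rule reduction_next)
        then show "reaches (skip_fd 1) s3 1
            (\<lambda>s3. fst s3 0 = i \<and> R (Suc i) 0 ((fst s3)(0 := Suc i), snd s3))"
          unfolding skip_fd_def using s3 L(2) R_len(2)[of i m s3]
          by (intro reaches_Assign) (auto simp: R_def)
      qed
    next
      fix s4 assume "R ?n 0 s4"
      then show "Q s4" unfolding R_def using Q by blast
    qed (auto dest: R_len)
  qed (use M in \<open>auto simp: S_def fds_at_def\<close>)
  then show ?thesis by (rule reaches_mono) (auto simp: algebra_simps)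
qed

end

section \<open>Agreement of the memory layout with the encoding\<close>

lemma nth_concat_map_uniform:
  assumes "\<And>x. x \<in> set xs \<Longrightarrow> length (f x) = q" "i < length xs" "k < q"
  shows "concat (map f xs) ! (q * i + k) = f (xs ! i) ! k"
  using assms(1,2)
proof (induction xs arbitrary: i)
  case (Cons x xs)
  then show ?case using assms(3) by (cases i) (auto simp: nth_append)
qed simp

lemma length_concat_map_uniform:
  "(\<And>x. x \<in> set xs \<Longrightarrow> length (f x) = q) \<Longrightarrow> length (concat (map f xs)) = q * length xs"
  by (induction xs) auto

context attribute_numbering
begin

text \<open>Used in both directions: the input state satisfies the layout, and the final layout is
  the required initial segment of the output.\<close>

lemma fds_at_iff_fd_code:
  "fds_at M L \<longleftrightarrow> (\<forall>i<length (fd_code U num L). M i = fd_code U num L ! i)"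
proof -
  let ?f = "\<lambda>(X, Y). bits m (num ` X) @ bits m (num ` Y)"
  let ?c = "concat (map ?f L)"
  have code: "fd_code U num L = length L # m # ?c" by (simp add: fd_code_def card_U)
  have lenf: "length (?f x) = 2 * m" for x by (cases x) (simp add: bits_def)
  have lenc: "length ?c = 2 * m * length L" by (rule length_concat_map_uniform) (rule lenf)
  have nth: "?c ! (2 * m * i + k) = of_bool (k \<in> num ` fst (L ! i))"
    "?c ! (2 * m * i + (m + k)) = of_bool (k \<in> num ` snd (L ! i))"
    if "i < length L" "k < m" for i k
    using that nth_concat_map_uniform[of L ?f "2 * m" i k, OF lenf]
      nth_concat_map_uniform[of L ?f "2 * m" i "m + k", OF lenf]
    by (auto simp: bits_def nth_append split: prod.split)
  have "(\<forall>i<length (fd_code U num L). M i = fd_code U num L ! i) \<longleftrightarrow>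
      M 0 = length L \<and> M 1 = m \<and> (\<forall>j<2 * m * length L. M (2 + j) = ?c ! j)"
    by (auto simp: code lenc All_less_Suc2)
  also have "(\<forall>j<2 * m * length L. M (2 + j) = ?c ! j) \<longleftrightarrow>
      (\<forall>i<length L. \<forall>k<2 * m. M (2 + (2 * m * i + k)) = ?c ! (2 * m * i + k))"
  proof (intro iffI allI impI)
    fix i k assume "\<forall>j<2 * m * length L. M (2 + j) = ?c ! j" "i < length L" "k < 2 * m"
    then show "M (2 + (2 * m * i + k)) = ?c ! (2 * m * i + k)"
      using block_address_le[of i "length L" "2 * m"] by auto
  next
    fix j assume all: "\<forall>i<length L. \<forall>k<2 * m. M (2 + (2 * m * i + k)) = ?c ! (2 * m * i + k)"
      and j: "j < 2 * m * length L"
    \<comment> \<open>Cell \<open>j\<close> lies in record \<open>j div (2 * m)\<close>. For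
      \<open>m = 0\<close> there is no such \<open>j\<close>.\<close>
    have "0 < 2 * m" using j by (cases m) auto
    then have "j mod (2 * m) < 2 * m" by (rule mod_less_divisor)
    moreover have "j div (2 * m) < length L"
      using j by (intro less_mult_imp_div_less) (simp add: mult.commute)
    ultimately show "M (2 + j) = ?c ! j"
      using all[rule_format, of "j div (2 * m)" "j mod (2 * m)"] by (simp only: mult_div_mod_eq)
  qed
  also have "\<dots> \<longleftrightarrow> (\<forall>i<length L. \<forall>k<m. M (2 + (2 * m * i + k)) = ?c ! (2 * m * i + k) \<and>
      M (2 + (2 * m * i + (m + k))) = ?c ! (2 * m * i + (m + k)))"
  proof -
    have "(\<forall>k<2 * m. P k) \<longleftrightarrow> (\<forall>k<m. P k \<and> P (m + k))" for P
    proof (intro iffI allI impI)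
      fix k assume P: "\<forall>k<m. P k \<and> P (m + k)" "k < 2 * m"
      then show "P k" using P(1)[rule_format, of "k - m"] by (cases "k < m") auto
    qed auto
    then show ?thesis by simp
  qed
  also have "\<dots> \<longleftrightarrow> (\<forall>i<length L. \<forall>k<m. M (2 + (2 * m * i + k)) = of_bool (k \<in> num ` fst (L ! i)) \<and>
      M (2 + (2 * m * i + (m + k))) = of_bool (k \<in> num ` snd (L ! i)))"
    by (simp only: nth cong: imp_cong)
  finally show ?thesis unfolding fds_at_def bits_at_def add.assoc by blast
qed

end

theorem corollary1:
  "\<exists>(c :: com) (p :: nat poly).
     \<forall>(S :: ('e, 'v, 'd) eqsys) \<phi> \<upsilon> \<Sigma> U num fds.
       complete_structure S \<and>
       \<phi> \<notin> vars S \<and> \<upsilon> \<notin> vars S \<and> \<phi> \<noteq> \<upsilon> \<and>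
       h_encode \<phi> \<upsilon> S \<Sigma> \<and>
       U = vars S \<union> {\<phi>, \<upsilon>} \<and>
       bij_betw num U {0..<card U} \<and> distinct fds \<and> set fds = \<Sigma>
       \<longrightarrow>
       (\<exists>\<Sigma>' fds'.
          fd_set U \<Sigma>' \<and> parsimonious U \<Sigma>' \<and> fd_closure U \<Sigma>' = fd_closure U \<Sigma> \<and>
          distinct fds' \<and> set fds' = \<Sigma>' \<and>
          computes_within c (fd_code U num fds) (poly p (card \<Sigma> * card U))
            (fd_code U num fds'))"
proof -
  \<comment> \<open>The time bound of \<open>main_com\<close> with \<open>x\<close> in place of both
    the number of fds and the number of attributes.\<close>
  define p :: "nat poly" where "p = (let x = [:0, 1:] in
    6 + x * (8 + x * (12 + 6 * x + x * (5 + x * (8 + 6 * x)))))"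
  have p: "poly p x = 6 + x * (8 + x * (12 + 6 * x + x * (5 + x * (8 + 6 * x))))" for x
    by (simp add: p_def Let_def)
  have "\<exists>\<Sigma>' fds'. fd_set U \<Sigma>' \<and> parsimonious U \<Sigma>' \<and> fd_closure U \<Sigma>' = fd_closure U (set fds) \<and>
      distinct fds' \<and> set fds' = \<Sigma>' \<and>
      computes_within main_com (fd_code U num fds) (poly p (card (set fds) * card U)) (fd_code U num fds')"
    if S: "complete_structure S" "\<phi> \<notin> vars S" "\<upsilon> \<notin> vars S" "h_encode \<phi> \<upsilon> S (set fds)"
      and U: "U = vars S \<union> {\<phi>, \<upsilon>}" and num: "bij_betw num U {0..<card U}" and dist: "distinct fds"
    for S :: "('e, 'v, 'd) eqsys" and \<phi> \<upsilon> U num fds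
  proof -
    interpret attribute_numbering U num "card U" by unfold_locales (rule num)
    let ?n = "length fds" and ?m = "card U"
    have sep: "separated U (set fds)" unfolding U using S by (rule h_encode_separated)
    have "fds_at (snd (input_state (fd_code U num fds))) fds"
      unfolding fds_at_iff_fd_code by (simp add: input_state_def)
    from main_com[OF this sep dist, where Q = "\<lambda>s. \<exists>L. fds_at (snd s) L \<and> reduction U num fds ?n 0 L"]
    obtain t s L where run: "t \<le> 6 + ?n * (8 + ?m * (12 + 6 * ?m + ?m * (5 + ?n * (8 + 6 * ?m))))"
        "exec main_com (input_state (fd_code U num fds)) t s"
      and L: "fds_at (snd s) L" "reduction U num fds ?n 0 L"
      unfolding reaches_def by blast
    \<comment> \<open>If both counts are positive, each is at most their product, and the bound is
      monotone. Without fds the product vanishes, but the bound is then the constant 6.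
      \<open>U\<close> is never empty because it contains \<open>\<phi>\<close>.\<close>
    have "6 + ?n * (8 + ?m * (12 + 6 * ?m + ?m * (5 + ?n * (8 + 6 * ?m)))) \<le> poly p (?n * ?m)"
    proof (cases "?n = 0")
      case False
      have "0 < ?m" unfolding card_gt_0_iff using finite_U U by blast
      then have "?n \<le> ?n * ?m" "?m \<le> ?n * ?m" using False by (auto simp: Suc_le_eq)
      then show ?thesis unfolding p by (intro add_mono mult_mono order_refl) auto
    qed (simp add: p)
    then have "computes_within main_com (fd_code U num fds) (poly p (card (set fds) * ?m)) (fd_code U num L)"
      using run L(1) unfolding computes_within_def fds_at_iff_fd_code distinct_card[OF dist]
      by (meson order_trans)
    moreover have "fd_closure U (set L) = fd_closure U (set fds)" using L(2) by (rule reductionD)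
    moreover have "parsimonious U (set L)" using L(2) sep dist by (rule reduction_final)
    ultimately show ?thesis
      using reduction_separated[OF L(2) sep dist] separated_fd_set by blast
  qed
  then show ?thesis by (intro exI[of _ main_com] exI[of _ p]) blast
qed

end
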